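(* Assume $X\subseteq\mathbb{R}^n$ and $\Theta\subseteq\mathbb{R}^d$ are convex and compact, and: (i) $h(x;\theta)=A(\theta)x+b(\theta)$ with $A(\theta)\in\mathbb{R}^{m\times n}$, $b(\theta)\in\mathbb{R}^m$, and there are constants $L_A,L_b$ with $\|A(\theta)-A(\theta^* )\|\le L_A\|\theta-\theta^*\|$ and $\|b(\theta)-b(\theta^* )\|\le L_b\|\theta-\theta^*\|$ for all $\theta\in\Theta$; (ii) $f(\cdot;\theta)$ is convex on $X$ for all $\theta\in\Theta$, and $|f(x;\theta)-f(x;\theta^* )|\le L_{f,\theta}\|\theta-\theta^*\|$ for all $\theta\in\Theta$, $x\in X$; (iii) there is a continuous function $\kappa:\mathcal{K}^*\to\mathbb{R}$ with positive values such that $X^*(\lambda;\theta)\subseteq X^*(\lambda;\theta^* )+\kappa(\lambda)\|\theta-\theta^*\|\,\mathcal{B}(\mathbf{0},1)$ for all $\lambda\in\mathcal{K}^*$, $\theta\in\Theta$. Let $\{\theta_k\}_{k\ge 0}\subseteq\Theta$ satisfy $\|\theta_k-\theta^*\|\le\tau^k\|\theta_0-\theta^*\|$ for all $k\ge0$, for some $\tau\in(0,1)$. Let $\{x_k\}$, $\{\lambda_k\}$ be generated by IPALM with constant penalty $\rho_k=\rho>0$ and tolerances $\alpha_k\ge 0$ with $\sum_{k=0}^\infty\sqrt{\alpha_k}<\infty$, and let $\bar x_k=\frac1k\sum_{i=1}^kx_i$. Then for any $\lambda^*\in\operatorname{argmax}_\lambda g_0(\lambda;\theta^* )$ and all $k\ge1$,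 $$f(\bar x_k;\theta^* )-f^*\ge-\frac\rho2\mathcal{V}^2(k)-\|\lambda^*\|\,\mathcal{V}(k),\qquad f(\bar x_k;\theta^* )-f^*\le\frac Uk,$$ where $$U\triangleq\sum_{i=0}^\infty\alpha_i+\frac{1}{2\rho}\|\lambda_0\|^2+\frac\rho2L_{h,\theta}^2\frac{\|\theta_0-\theta^*\|^2}{1-\tau^2}+\big(\bar CL_{h,\theta}+2L_{f,\theta}\big)\frac{\|\theta_0-\theta^*\|}{1-\tau},\qquad \bar C\triangleq C_\lambda+\|\lambda^*\|,$$ $\mathcal{V}(k)\triangleq\frac{C_1}{\sqrt k}+\frac{C_2}{k}$, and $$C_1\triangleq\sqrt{\frac{2B_g}{\rho}+\Big(\frac{C_\lambda}{\rho}\Big)^2},\qquad C_2\triangleq\sqrt{\tfrac2\rho}\sum_{i=0}^\infty\sqrt{\alpha_i}+\frac{(L_{h,\theta}+\bar\kappa)\|\theta_0-\theta^*\|}{1-\tau},$$ $$B_g\triangleq\frac{1}{2\rho}\|\lambda_0-\lambda^*\|^2+C_\lambda\Big(\sqrt{\tfrac{2}{\rho}}\sum_{k=0}^\infty\sqrt{\alpha_k}+\frac{\bar\kappa\|\theta_0-\theta^*\|}{1-\tau}\Big),$$ $$C_\lambda\triangleq\sqrt{2\rho}\sum_{i=0}^\infty\sqrt{\alpha_i}+\rho\,\kappa_d(\lambda^* )\frac{\|\theta_0-\theta^*\|}{1-\tau}+\|\lambda_0-\lambda^*\|,\qquad \bar\kappa\triangleq\sup_{k\ge1}\kappa_d(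\lambda_k).$$
   Context: $\|\cdot\|$ is the Euclidean norm (spectral norm for matrices), $\mathcal{B}(\mathbf{0},1)$ the closed unit ball. $\mathcal{K}\subseteq\mathbb{R}^m$ is a closed convex cone, $\mathcal{K}^*$ its dual cone; for a closed convex set $C$, $\Pi_C$ is the Euclidean projection and $d_C(y)=\min_{s\in C}\|y-s\|$. $f:\mathbb{R}^n\times\Theta\to\mathbb{R}\cup\{+\infty\}$, $h:\mathbb{R}^n\times\Theta\to\mathbb{R}^m$; $\mathcal{C}(\theta):\ \min_x\{f(x;\theta):-h(x;\theta)\in\mathcal{K},\ x\in X\}$. $\theta^*\in\Theta$ is a fixed parameter (the unique minimizer over $\Theta$ of a learning objective). Standing assumption: $\mathcal{C}(\theta^* )$ has finite optimal value $f^*$ (attained on its solution set), its Lagrangian dual has a solution, and there is no duality gap. Lagrangian: $\mathcal{L}_0(x,\lambda;\theta)=f(x;\theta)+\lambda^\top h(x;\theta)$ if $\lambda\in\mathcal{K}^*$, and $-\infty$ otherwise. For $\rho>0$: $\mathcal{L}_\rho(x,\lambda;\theta)=f(x;\theta)+\frac{\rho}{2}d^2_{-\mathcal{K}}\big(h(x;\theta)+\frac{\lambda}{\rho}\big)-\frac{\|\lambda\|^2}{2\rho}$. For $\rho\ge 0$: $g_\rho(\lambda;\theta)=\inf_{x\in X}\mathcal{L}_\rho(x,\lambda;\theta)$. For $\rho>0$, $\nabla_\lambda\mathcal{L}_\rho(x,\lambda;\theta)=\Pi_{\mathcal{K}^*}\big(\frac{\lambda}{\rho}+h(x;\theta)\big)-\frac{\lambda}{\rho}$.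 $X^*(\lambda;\theta)=\operatorname{argmin}_{x\in X}\mathcal{L}_0(x,\lambda;\theta)$. Constants: $D_x=\max_{x\in X}\|x\|$, $L_{h,\theta}=L_AD_x+L_b$, $L_{h,x}=\max_{\theta\in\Theta}\|A(\theta)\|$ ($\|A(\cdot)\|$ is taken to be continuous on $\Theta$), $\kappa_d(\lambda)=L_{h,\theta}+\kappa(\lambda)L_{h,x}$. IPALM (inexact parametric augmented Lagrangian method): given $\lambda_0\in\mathcal{K}^*$, $x_0\in X$, penalties $\{\rho_k\}\subset(0,\infty)$, tolerances $\{\alpha_k\}$, and $\{\theta_k\}$, for each $k\ge0$: (1) choose any $x_{k+1}\in X$ with $\mathcal{L}_{\rho_k}(x_{k+1},\lambda_k;\theta_k)\le g_{\rho_k}(\lambda_k;\theta_k)+\alpha_k$; (2) set $\lambda_{k+1}=\lambda_k+\rho_k\nabla_\lambda\mathcal{L}_{\rho_k}(x_{k+1},\lambda_k;\theta_k)$, i.e. $\lambda_{k+1}=\Pi_{\mathcal{K}^*}(\lambda_k+\rho_kh(x_{k+1};\theta_k))$.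
   Formalization: It is additionally assumed that X*(λ;θ) is nonempty for all λ in K* and θ in Θ (automatic if f(·;θ) is lower semicontinuous on X); otherwise (iii) can hold vacuously and the lower bound can fail. *)

theory Defs
  imports "HOL-Analysis.Analysis"
begin

definition dual_cone :: "'a::real_inner set \<Rightarrow> 'a set" where
  "dual_cone K = {y. \<forall>s\<in>K. 0 \<le> s \<bullet> y}"

(* Convexity of an extended-valued function; meant for f that never takes the value -\<infinity>.
   The endpoints t = 0, 1 are harmless because 0 * \<infinity> = 0 in ereal. *)
definition ereal_convex_on :: "'a::real_vector set \<Rightarrow> ('a \<Rightarrow> ereal) \<Rightarrow> bool" where
  "ereal_convex_on S f \<longleftrightarrow>
     (\<forall>x\<in>S. \<forall>y\<in>S. \<forall>t\<in>{0..1}.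
        f ((1 - t) *\<^sub>R x + t *\<^sub>R y) \<le> ereal (1 - t) * f x + ereal t * f y)"

definition spectral_norm :: "real^'n^'m \<Rightarrow> real" where
  "spectral_norm M = onorm ((*v) M)"

definition feasible ::
  "('m::euclidean_space) set \<Rightarrow> ('x \<Rightarrow> 'p \<Rightarrow> 'm) \<Rightarrow> 'x set \<Rightarrow> 'p \<Rightarrow> 'x set" where
  "feasible K h X \<theta> = {x \<in> X. - h x \<theta> \<in> K}"

definition opt_value ::
  "('m::euclidean_space) set \<Rightarrow> ('x \<Rightarrow> 'p \<Rightarrow> ereal) \<Rightarrow> ('x \<Rightarrow> 'p \<Rightarrow> 'm) \<Rightarrow> 'x set \<Rightarrow> 'p \<Rightarrow> ereal" where
  "opt_value K f h X \<theta> = (INF x\<in>feasible K h X \<theta>. f x \<theta>)"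

(* The whole family of Lagrangians: rho = 0 is the ordinary one, rho > 0 the augmented ones
   (negative rho is never used). *)
definition lagrangian ::
  "('m::euclidean_space) set \<Rightarrow> ('x \<Rightarrow> 'p \<Rightarrow> ereal) \<Rightarrow> ('x \<Rightarrow> 'p \<Rightarrow> 'm) \<Rightarrow>
     real \<Rightarrow> 'x \<Rightarrow> 'm \<Rightarrow> 'p \<Rightarrow> ereal" where
  "lagrangian K f h \<rho> x lam \<theta> =
     (if \<rho> = 0 then
        (if lam \<in> dual_cone K then f x \<theta> + ereal (lam \<bullet> h x \<theta>) else - \<infinity>)
      else
        f x \<theta> + ereal (\<rho> / 2 * (infdist (h x \<theta> + lam /\<^sub>R \<rho>) (uminus ` K))\<^sup>2)
          - ereal ((norm lam)\<^sup>2 / (2 * \<rho>)))"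

definition dual_fun ::
  "('m::euclidean_space) set \<Rightarrow> ('x \<Rightarrow> 'p \<Rightarrow> ereal) \<Rightarrow> ('x \<Rightarrow> 'p \<Rightarrow> 'm) \<Rightarrow> 'x set \<Rightarrow>
     real \<Rightarrow> 'm \<Rightarrow> 'p \<Rightarrow> ereal" where
  "dual_fun K f h X \<rho> lam \<theta> = (INF x\<in>X. lagrangian K f h \<rho> x lam \<theta>)"

(* The gradient of lagrangian K f h rho x (for rho > 0) with respect to the multiplier,
   in closed form. *)
definition grad_lagrangian ::
  "('m::euclidean_space) set \<Rightarrow> ('x \<Rightarrow> 'p \<Rightarrow> 'm) \<Rightarrow> real \<Rightarrow> 'x \<Rightarrow> 'm \<Rightarrow> 'p \<Rightarrow> 'm" where
  "grad_lagrangian K h \<rho> x lam \<theta> =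
     closest_point (dual_cone K) (lam /\<^sub>R \<rho> + h x \<theta>) - lam /\<^sub>R \<rho>"

definition lagr_argmin ::
  "('m::euclidean_space) set \<Rightarrow> ('x \<Rightarrow> 'p \<Rightarrow> ereal) \<Rightarrow> ('x \<Rightarrow> 'p \<Rightarrow> 'm) \<Rightarrow> 'x set \<Rightarrow>
     'm \<Rightarrow> 'p \<Rightarrow> 'x set" where
  "lagr_argmin K f h X lam \<theta> = {x. is_arg_min (\<lambda>x. lagrangian K f h 0 x lam \<theta>) (\<lambda>x. x \<in> X) x}"

definition dual_solutions ::
  "('m::euclidean_space) set \<Rightarrow> ('x \<Rightarrow> 'p \<Rightarrow> ereal) \<Rightarrow> ('x \<Rightarrow> 'p \<Rightarrow> 'm) \<Rightarrow> 'x set \<Rightarrow>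
     'p \<Rightarrow> 'm set" where
  "dual_solutions K f h X \<theta> = {lam. is_arg_max (\<lambda>lam. dual_fun K f h X 0 lam \<theta>) (\<lambda>_. True) lam}"

definition ipalm ::
  "('m::euclidean_space) set \<Rightarrow> ('x \<Rightarrow> 'p \<Rightarrow> ereal) \<Rightarrow> ('x \<Rightarrow> 'p \<Rightarrow> 'm) \<Rightarrow> 'x set \<Rightarrow>
     (nat \<Rightarrow> real) \<Rightarrow> (nat \<Rightarrow> real) \<Rightarrow> (nat \<Rightarrow> 'p) \<Rightarrow> (nat \<Rightarrow> 'x) \<Rightarrow> (nat \<Rightarrow> 'm) \<Rightarrow> bool" where
  "ipalm K f h X \<rho> \<alpha> \<theta> x lam \<longleftrightarrow>
     lam 0 \<in> dual_cone K \<and> x 0 \<in> X \<and> (\<forall>k. 0 < \<rho> k) \<and>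
     (\<forall>k. x (Suc k) \<in> X \<and>
          lagrangian K f h (\<rho> k) (x (Suc k)) (lam k) (\<theta> k)
            \<le> dual_fun K f h X (\<rho> k) (lam k) (\<theta> k) + ereal (\<alpha> k) \<and>
          lam (Suc k) = lam k + \<rho> k *\<^sub>R grad_lagrangian K h (\<rho> k) (x (Suc k)) (lam k) (\<theta> k))"

end

theory Submission
  imports Defs
begin

text \<open>
  The multiplier iteration of the augmented Lagrangian method is an inexact proximal point iteration
  on the dual function. Since the penalty is the maximum of a strongly concave function of the
  multiplier, a separation argument (\<open>augmented_duality\<close>) identifies the infimum of the augmented
  Lagrangian with the proximal value of the dual function, and an \<open>\<alpha>\<close>-minimizer produces a
  multiplier within \<open>sqrt (2 * \<rho> * \<alpha>)\<close> of the exact proximal point (\<open>dual_prox_exists\<close>).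

  The proximal map is nonexpansive, and a dual solution \<open>\<lambda>\<^sup>*\<close> at \<open>\<theta>\<^sup>*\<close> is a fixed point of the
  proximal map for \<open>\<theta>\<^sup>*\<close>. For another parameter \<open>\<theta>\<close> it moves by at most
  \<open>\<rho> \<kappa>\<^sub>d(\<lambda>\<^sup>*) \<parallel>\<theta> - \<theta>\<^sup>*\<parallel>\<close> (\<open>dual_prox_perturbation\<close>). This is the delicate step, since the
  assumed inclusion of argmin sets goes in one direction only; concavity of the dual function along a
  segment and continuity of \<open>\<kappa>\<close> make up for that. Summing the errors bounds all multipliers:
  \<open>\<parallel>\<lambda>\<^sub>k - \<lambda>\<^sup>*\<parallel> \<le> C\<^sub>\<lambda>\<close>.

  Both estimates then follow by telescoping. For the upper one, compare each primal step with a
  solution of the unperturbed problem: the penalty of the new iterate is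
  \<open>(\<parallel>\<lambda>\<^sub>i\<^sub>+\<^sub>1\<parallel>\<^sup>2 - \<parallel>\<lambda>\<^sub>i\<parallel>\<^sup>2) / (2 \<rho>)\<close>, and the penalty of the solution is of the order of the parameter
  error; convexity of the objective passes to the average. For the lower one,
  \<open>h(x\<^sub>i\<^sub>+\<^sub>1;\<theta>\<^sub>i)\<close> exceeds \<open>(\<lambda>\<^sub>i\<^sub>+\<^sub>1 - \<lambda>\<^sub>i) / \<rho>\<close> by an element of \<open>- K\<close>, so the infeasibility of the
  average is governed by \<open>\<parallel>\<lambda>\<^sub>k - \<lambda>\<^sub>0\<parallel> / (\<rho> k)\<close> and the mean parameter error, and weak
  duality with \<open>\<lambda>\<^sup>*\<close> turns this into a bound on the objective. For \<open>k \<ge> 2\<close> boundedness of the multipliers gives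
  \<open>\<parallel>\<lambda>\<^sub>k - \<lambda>\<^sub>0\<parallel> / (\<rho> k) \<le> C\<^sub>1 / sqrt k\<close>; for \<open>k = 1\<close> it comes from the nonexpansiveness of
  the displacement of the proximal map (\<open>first_step_length\<close>).\<close>

section \<open>Projection onto the dual cone\<close>

lemma norm_diff_three_points:
  fixes u p v :: "'a::real_inner"
  shows "(norm (u - v))\<^sup>2 = (norm (u - p))\<^sup>2 + 2 * ((u - p) \<bullet> (p - v)) + (norm (p - v))\<^sup>2"
  by (simp add: power2_norm_eq_inner inner_diff_left inner_diff_right inner_commute)

lemma convex_dual_cone: "convex (dual_cone K)"
  by (auto simp: convex_def dual_cone_def inner_add_right)

lemma dual_cone_segment:
  "\<mu> \<in> dual_cone K \<Longrightarrow> \<nu> \<in> dual_cone K \<Longrightarrow> 0 \<le> t \<Longrightarrow> t \<le> 1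
    \<Longrightarrow> (1 - t) *\<^sub>R \<mu> + t *\<^sub>R \<nu> \<in> dual_cone K"
  using convexD_alt[OF convex_dual_cone] by blast

lemma closed_dual_cone: "closed (dual_cone K)"
proof -
  have "dual_cone K = (\<Inter>s\<in>K. {y. 0 \<le> s \<bullet> y})"
    by (auto simp: dual_cone_def)
  then show ?thesis
    by (auto intro!: closed_INT closed_Collect_le continuous_intros)
qed

lemma zero_in_dual_cone: "0 \<in> dual_cone K"
  by (simp add: dual_cone_def)

lemma scaleR_in_dual_cone: "\<mu> \<in> dual_cone K \<Longrightarrow> 0 \<le> c \<Longrightarrow> c *\<^sub>R \<mu> \<in> dual_cone K"
  by (simp add: dual_cone_def)

text \<open>Moreau's decomposition. Projecting onto \<open>- K\<close> first and showing that the residual is the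
  projection onto the dual cone gives all four facts without the bipolar theorem.\<close>
lemma projection_dual_cone:
  fixes K :: "'m::euclidean_space set"
  assumes K: "closed K" "convex K" "cone K" "K \<noteq> {}"
  defines "P \<equiv> closest_point (dual_cone K)"
  shows "P w \<in> dual_cone K"
    and "(w - P w) \<bullet> P w = 0"
    and "\<mu> \<in> dual_cone K \<Longrightarrow> \<mu> \<bullet> (w - P w) \<le> 0"
    and "infdist w (uminus ` K) = norm (P w)"
proof -
  let ?N = "uminus ` K"
  define q where "q = closest_point ?N w"
  have N: "closed ?N" "convex ?N" "?N \<noteq> {}"
    using K by (auto intro: closed_negations convex_negations)
  have qN: "q \<in> ?N"
    unfolding q_def using N by (intro closest_point_in_set)
  have scale: "c *\<^sub>R z \<in> ?N" if "z \<in> ?N" "0 \<le> c" for z c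
    using that K(3) unfolding cone_def by (force simp: image_iff)
  have dot: "(w - q) \<bullet> (z - q) \<le> 0" if "z \<in> ?N" for z
    unfolding q_def using N that by (intro closest_point_dot)
  have orth: "(w - q) \<bullet> q = 0"
    using dot[OF scale[OF qN, of 2]] dot[OF scale[OF qN, of 0]]
    by (simp add: inner_diff_right scaleR_2 inner_add_right)
  have neg: "(w - q) \<bullet> z \<le> 0" if "z \<in> ?N" for z
    using dot[OF that] orth by (simp add: inner_diff_right)
  have wq: "w - q \<in> dual_cone K"
    using neg by (force simp: dual_cone_def inner_commute)
  have pol: "\<mu> \<bullet> q \<le> 0" if "\<mu> \<in> dual_cone K" for \<mu>
    using that qN by (auto simp: dual_cone_def inner_commute)
  have P: "P w = w - q"
    unfolding P_def
  proof (rule closest_point_unique[symmetric, OF convex_dual_cone closed_dual_cone wq], rule ballI)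
    fix z assume z: "z \<in> dual_cone K"
    have "(norm (z - w))\<^sup>2 = (norm (z - (w - q)))\<^sup>2 + 2 * ((z - (w - q)) \<bullet> ((w - q) - w))
            + (norm ((w - q) - w))\<^sup>2"
      by (rule norm_diff_three_points)
    moreover have "(z - (w - q)) \<bullet> ((w - q) - w) \<ge> 0"
      using pol[OF z] orth by (simp add: inner_diff_left inner_diff_right inner_commute)
    ultimately have "(norm ((w - q) - w))\<^sup>2 \<le> (norm (z - w))\<^sup>2"
      using zero_le_power2[of "norm (z - (w - q))"] by linarith
    then have "norm ((w - q) - w) \<le> norm (z - w)"
      by (rule power2_le_imp_le) simp
    then show "dist w (w - q) \<le> dist w z"
      by (simp add: dist_norm norm_minus_commute)
  qed
  show "P w \<in> dual_cone K" by (simp add: P wq)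
  show "(w - P w) \<bullet> P w = 0" using orth by (simp add: P inner_commute)
  show "\<mu> \<bullet> (w - P w) \<le> 0" if "\<mu> \<in> dual_cone K" for \<mu> using pol[OF that] by (simp add: P)
  show "infdist w ?N = norm (P w)"
    using setdist_closest_point[OF N(1,3), of w]
    by (simp add: infdist_eq_setdist P q_def dist_norm)
qed

section \<open>The quadratic penalty and the multiplier step\<close>

text \<open>The summand by which the augmented Lagrangian differs from the objective, as a function of the
  multiplier \<open>v\<close> and of the constraint value \<open>u\<close>.\<close>
definition penalty :: "'m::euclidean_space set \<Rightarrow> real \<Rightarrow> 'm \<Rightarrow> 'm \<Rightarrow> real" where
  "penalty K \<rho> v u = \<rho> / 2 * (infdist (u + v /\<^sub>R \<rho>) (uminus ` K))\<^sup>2 - (norm v)\<^sup>2 / (2 * \<rho>)"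

text \<open>The update is kept in the form \<open>v\<close> plus \<open>\<rho>\<close> times the gradient of the penalty in \<open>v\<close>; it equals
  the projection of \<open>v + \<rho> u\<close> onto the dual cone.\<close>
definition multiplier_step :: "'m::euclidean_space set \<Rightarrow> real \<Rightarrow> 'm \<Rightarrow> 'm \<Rightarrow> 'm" where
  "multiplier_step K \<rho> v u = v + \<rho> *\<^sub>R (closest_point (dual_cone K) (v /\<^sub>R \<rho> + u) - v /\<^sub>R \<rho>)"

locale penalty_cone =
  fixes K :: "'m::euclidean_space set" and \<rho> :: real
  assumes closed_K: "closed K" and convex_K: "convex K" and cone_K: "cone K"
    and K_nonempty: "K \<noteq> {}" and rho_pos: "0 < \<rho>"
begin

lemma multiplier_step_eq:
  "multiplier_step K \<rho> v u = \<rho> *\<^sub>R closest_point (dual_cone K) (v /\<^sub>R \<rho> + u)"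
  using rho_pos by (simp add: multiplier_step_def scaleR_diff_right)

lemma multiplier_step_in: "multiplier_step K \<rho> v u \<in> dual_cone K"
  using rho_pos projection_dual_cone(1)[OF closed_K convex_K cone_K K_nonempty]
  by (simp add: multiplier_step_eq scaleR_in_dual_cone)

lemma penalty_eq_norm_step:
  "penalty K \<rho> v u = ((norm (multiplier_step K \<rho> v u))\<^sup>2 - (norm v)\<^sup>2) / (2 * \<rho>)"
  using rho_pos projection_dual_cone(4)[OF closed_K convex_K cone_K K_nonempty, of "v /\<^sub>R \<rho> + u"]
  by (simp add: penalty_def multiplier_step_eq add.commute power2_eq_square field_simps)

text \<open>The residual of the projection lies in \<open>- K\<close>. Hence the increments of the multiplier dominate the
  constraint values in every direction of the dual cone, and increments telescope: this is what
  bounds the infeasibility of averaged iterates.\<close>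
lemma inner_constraint_le_step:
  assumes "\<mu> \<in> dual_cone K"
  shows "\<rho> * (\<mu> \<bullet> u) \<le> \<mu> \<bullet> (multiplier_step K \<rho> v u - v)"
proof -
  let ?w = "v /\<^sub>R \<rho> + u"
  have "\<mu> \<bullet> (?w - closest_point (dual_cone K) ?w) \<le> 0"
    using projection_dual_cone(3)[OF closed_K convex_K cone_K K_nonempty assms] .
  then have "\<rho> * (\<mu> \<bullet> (?w - closest_point (dual_cone K) ?w)) \<le> 0"
    using rho_pos by (simp add: mult_le_0_iff)
  then show ?thesis
    using rho_pos
    by (simp add: multiplier_step_eq inner_diff_right inner_add_right right_diff_distrib distrib_left
        flip: mult.assoc)
qed

lemma inner_step_eq:
  fixes u v :: 'm
  defines "v' \<equiv> multiplier_step K \<rho> v u"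
  shows "\<rho> * (v' \<bullet> u) = v' \<bullet> (v' - v)"
proof -
  let ?w = "v /\<^sub>R \<rho> + u"
  have "(?w - closest_point (dual_cone K) ?w) \<bullet> closest_point (dual_cone K) ?w = 0"
    using projection_dual_cone(2)[OF closed_K convex_K cone_K K_nonempty] .
  then have "(\<rho> *\<^sub>R (?w - closest_point (dual_cone K) ?w)) \<bullet> v' = 0"
    by (simp add: v'_def multiplier_step_eq)
  moreover have "\<rho> *\<^sub>R (?w - closest_point (dual_cone K) ?w) = v + \<rho> *\<^sub>R u - v'"
    using rho_pos by (simp add: v'_def multiplier_step_eq algebra_simps)
  ultimately show ?thesis
    by (simp add: inner_diff_right inner_diff_left inner_add_left inner_add_right inner_commute)
qed

text \<open>The penalty is the maximum over \<open>\<mu>\<close> in the dual cone of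
  \<open>\<mu> \<bullet> u - (norm (\<mu> - v))\<^sup>2 / (2 * \<rho>)\<close>, attained at the multiplier step. The second square
  is the amount by which strong concavity makes other \<open>\<mu>\<close> fall short of the maximum.\<close>
lemma penalty_ge:
  assumes "\<mu> \<in> dual_cone K"
  shows "\<mu> \<bullet> u - (norm (\<mu> - v))\<^sup>2 / (2 * \<rho>)
           + (norm (\<mu> - multiplier_step K \<rho> v u))\<^sup>2 / (2 * \<rho>) \<le> penalty K \<rho> v u"
proof -
  let ?s = "multiplier_step K \<rho> v u"
  have "2 * \<rho> * (\<mu> \<bullet> u) - (norm (\<mu> - v))\<^sup>2 + (norm (\<mu> - ?s))\<^sup>2 \<le> (norm ?s)\<^sup>2 - (norm v)\<^sup>2"
    using inner_constraint_le_step[OF assms, of u v]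
    by (simp add: power2_norm_eq_inner inner_diff_left inner_diff_right inner_commute)
  then have "(2 * \<rho> * (\<mu> \<bullet> u) - (norm (\<mu> - v))\<^sup>2 + (norm (\<mu> - ?s))\<^sup>2) / (2 * \<rho>)
      \<le> penalty K \<rho> v u"
    unfolding penalty_eq_norm_step using rho_pos by (intro divide_right_mono) auto
  then show ?thesis
    using rho_pos by (simp add: add_divide_distrib diff_divide_distrib)
qed

lemma penalty_eq_at_step:
  fixes u v :: 'm
  defines "v' \<equiv> multiplier_step K \<rho> v u"
  shows "penalty K \<rho> v u = v' \<bullet> u - (norm (v' - v))\<^sup>2 / (2 * \<rho>)"
proof -
  have "(norm v')\<^sup>2 - (norm v)\<^sup>2 = 2 * \<rho> * (v' \<bullet> u) - (norm (v' - v))\<^sup>2"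
    using inner_step_eq[of v u]
    by (simp add: v'_def power2_norm_eq_inner inner_diff_left inner_diff_right inner_commute)
  then show ?thesis
    using rho_pos unfolding penalty_eq_norm_step v'_def[symmetric]
    by (simp add: diff_divide_distrib)
qed

lemma convex_on_penalty: "convex_on UNIV (penalty K \<rho> v)"
proof (rule convex_onI)
  fix t :: real and u1 u2 :: 'm assume t: "0 < t" "t < 1"
  let ?u = "(1 - t) *\<^sub>R u1 + t *\<^sub>R u2"
  define s where "s = multiplier_step K \<rho> v ?u"
  define m where "m = (norm (s - v))\<^sup>2 / (2 * \<rho>)"
  have *: "s \<bullet> u - m \<le> penalty K \<rho> v u" for u :: 'm
    using penalty_ge[OF multiplier_step_in[of v ?u], of u v] rho_pos
      divide_nonneg_pos[OF zero_le_power2, of "2 * \<rho>" "norm (s - multiplier_step K \<rho> v u)"]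
    unfolding s_def[symmetric] m_def by linarith
  have "penalty K \<rho> v ?u = s \<bullet> ?u - m"
    using penalty_eq_at_step[of v ?u] by (simp add: s_def m_def)
  also have "\<dots> = (1 - t) * (s \<bullet> u1 - m)
                 + t * (s \<bullet> u2 - m)"
    by (simp add: inner_add_right algebra_simps)
  also have "\<dots> \<le> (1 - t) * penalty K \<rho> v u1 + t * penalty K \<rho> v u2"
    using t * by (intro add_mono mult_left_mono) auto
  finally show "penalty K \<rho> v ?u \<le> (1 - t) * penalty K \<rho> v u1 + t * penalty K \<rho> v u2" .
qed simp

text \<open>At this constraint value the maximum that defines the penalty is attained at the prescribed
  multiplier \<open>p\<close>, so a supporting inequality evaluated here produces the proximal term of \<open>p\<close>.\<close>
lemma penalty_recentred:
  assumes "p \<in> dual_cone K"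
  shows "penalty K \<rho> v ((p - v) /\<^sub>R \<rho>) = p \<bullet> ((p - v) /\<^sub>R \<rho>) - (norm (p - v))\<^sup>2 / (2 * \<rho>)"
proof -
  have "v /\<^sub>R \<rho> + (p - v) /\<^sub>R \<rho> = p /\<^sub>R \<rho>"
    by (simp add: scaleR_diff_right)
  then have "multiplier_step K \<rho> v ((p - v) /\<^sub>R \<rho>) = p"
    using rho_pos assms
    by (simp add: multiplier_step_eq closest_point_self scaleR_in_dual_cone)
  then show ?thesis
    using penalty_eq_at_step[of v "(p - v) /\<^sub>R \<rho>"] by simp
qed

lemma penalty_nonpos_on_polar:
  assumes "s \<in> K"
  shows "penalty K \<rho> v (- s) \<le> 0"
proof -
  have "multiplier_step K \<rho> v (- s) \<bullet> (- s) \<le> 0"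
    using multiplier_step_in[of v "- s"] assms by (auto simp: dual_cone_def inner_commute)
  then show ?thesis
    using rho_pos
      divide_nonneg_pos[OF zero_le_power2, of "2 * \<rho>" "norm (multiplier_step K \<rho> v (- s) - v)"]
    unfolding penalty_eq_at_step by linarith
qed

end

section \<open>Augmented duality and the dual proximal point\<close>

locale cone_program = penalty_cone K \<rho> for K :: "'m::euclidean_space set" and \<rho> :: real +
  fixes D :: "'x::real_vector set" and F :: "'x \<Rightarrow> real" and c :: "'x \<Rightarrow> 'm"
  assumes D_nonempty: "D \<noteq> {}" and F_convex: "convex_on D F"
    and c_affine: "\<And>y z t. c ((1 - t) *\<^sub>R y + t *\<^sub>R z) = (1 - t) *\<^sub>R c y + t *\<^sub>R c z"
    and minimum_attained:
      "\<And>\<mu>. \<mu> \<in> dual_cone K \<Longrightarrow> \<exists>y\<in>D. \<forall>z\<in>D. F y + \<mu> \<bullet> c y \<le> F z + \<mu> \<bullet> c z"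
begin

definition dual_value :: "'m \<Rightarrow> real" where
  "dual_value \<mu> = (INF y\<in>D. F y + \<mu> \<bullet> c y)"

lemma dual_value_attained:
  assumes "\<mu> \<in> dual_cone K"
  obtains y where "y \<in> D" "dual_value \<mu> = F y + \<mu> \<bullet> c y"
    "\<And>z. z \<in> D \<Longrightarrow> F y + \<mu> \<bullet> c y \<le> F z + \<mu> \<bullet> c z"
proof -
  obtain y where y: "y \<in> D" "\<forall>z\<in>D. F y + \<mu> \<bullet> c y \<le> F z + \<mu> \<bullet> c z"
    using minimum_attained[OF assms] by blast
  have "dual_value \<mu> = F y + \<mu> \<bullet> c y"
    unfolding dual_value_def by (rule cInf_eq_minimum) (use y in auto)
  with y that show ?thesis by blast
qed

lemma dual_value_le: "\<mu> \<in> dual_cone K \<Longrightarrow> y \<in> D \<Longrightarrow> dual_value \<mu> \<le> F y + \<mu> \<bullet> c y"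
  by (metis dual_value_attained)

text \<open>The part of the minimax identity for the augmented Lagrangian that does not come for free: a lower
  bound \<open>a\<close> of the augmented Lagrangian is certified by one multiplier \<open>p\<close>. The strict hypograph
  of \<open>a\<close> minus the penalty and the set of points above some \<open>(c y, F y)\<close> are convex and disjoint,
  and \<open>p\<close> is the slope of a hyperplane between them. The penalty is finite everywhere, so the
  hyperplane is not vertical.\<close>
lemma augmented_duality:
  assumes a: "\<And>y. y \<in> D \<Longrightarrow> a \<le> F y + penalty K \<rho> v (c y)"
  obtains p where "p \<in> dual_cone K"
    "\<And>y. y \<in> D \<Longrightarrow> a + (norm (p - v))\<^sup>2 / (2 * \<rho>) \<le> F y + p \<bullet> c y"
proof -
  let ?\<psi> = "penalty K \<rho> v"
  define S where "S = {(u, r). r < a - ?\<psi> u}"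
  define T where "T = {(u, r). \<exists>y\<in>D. u = c y \<and> F y \<le> r}"
  have S: "convex S"
  proof (rule convexI)
    fix z w and s t :: real
    assume z: "z \<in> S" "w \<in> S" and st: "0 \<le> s" "0 \<le> t" "s + t = 1"
    obtain u1 r1 u2 r2 where zw: "z = (u1, r1)" "w = (u2, r2)"
      by (metis surj_pair)
    have r: "r1 < a - ?\<psi> u1" "r2 < a - ?\<psi> u2" using z by (auto simp: S_def zw)
    have "?\<psi> (s *\<^sub>R u1 + t *\<^sub>R u2) \<le> s * ?\<psi> u1 + t * ?\<psi> u2"
      using convex_on_penalty[of v] st by (auto simp: convex_on_def)
    moreover have "s * r1 + t * r2 < s * (a - ?\<psi> u1) + t * (a - ?\<psi> u2)"
    proof (cases "s = 0")
      case True then show ?thesis using st r by simp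
    next
      case False
      then show ?thesis
        using st r by (intro add_less_le_mono mult_strict_left_mono mult_left_mono) auto
    qed
    moreover have "s * a + t * a = a" using st by (simp flip: distrib_right)
    ultimately have "s * r1 + t * r2 < a - ?\<psi> (s *\<^sub>R u1 + t *\<^sub>R u2)"
      by (simp add: right_diff_distrib)
    then show "s *\<^sub>R z + t *\<^sub>R w \<in> S" by (simp add: S_def zw)
  qed
  have T: "convex T"
  proof (rule convexI)
    fix z w and s t :: real
    assume z: "z \<in> T" "w \<in> T" and st: "0 \<le> s" "0 \<le> t" "s + t = 1"
    then obtain y1 r1 y2 r2 where zw: "z = (c y1, r1)" "w = (c y2, r2)"
      and y: "y1 \<in> D" "y2 \<in> D" "F y1 \<le> r1" "F y2 \<le> r2"
      by (auto simp: T_def)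
    have s: "s = 1 - t" using st by simp
    have "F (s *\<^sub>R y1 + t *\<^sub>R y2) \<le> s * F y1 + t * F y2"
      using F_convex y st by (auto simp: convex_on_def)
    also have "\<dots> \<le> s * r1 + t * r2" using y st by (intro add_mono mult_left_mono) auto
    finally have "F (s *\<^sub>R y1 + t *\<^sub>R y2) \<le> s * r1 + t * r2" .
    moreover have "s *\<^sub>R y1 + t *\<^sub>R y2 \<in> D"
      using convex_on_imp_convex[OF F_convex] y st by (simp add: convex_def)
    moreover have "c (s *\<^sub>R y1 + t *\<^sub>R y2) = s *\<^sub>R c y1 + t *\<^sub>R c y2"
      unfolding s by (rule c_affine)
    ultimately show "s *\<^sub>R z + t *\<^sub>R w \<in> T"
      unfolding T_def zw by (simp, metis)
  qed
  have disj: "S \<inter> T = {}"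
  proof (rule equals0I)
    fix z assume "z \<in> S \<inter> T"
    then obtain y r where "y \<in> D" "F y \<le> r" "r < a - ?\<psi> (c y)"
      by (auto simp: S_def T_def)
    with a[of y] show False by simp
  qed
  obtain y0 where y0: "y0 \<in> D" using D_nonempty by blast
  have "(0, a - ?\<psi> 0 - 1) \<in> S" "(c y0, F y0) \<in> T" using y0 by (auto simp: S_def T_def)
  then have ne: "S \<noteq> {}" "T \<noteq> {}" by blast+
  obtain n \<beta> where n: "n \<noteq> 0" "\<forall>z\<in>S. n \<bullet> z \<le> \<beta>" "\<forall>z\<in>T. n \<bullet> z \<ge> \<beta>"
    using separating_hyperplane_sets[OF S T ne disj] by blast
  obtain n1 n2 where n12: "n = (n1, n2)" by (cases n)
  have sep: "n1 \<bullet> u + n2 * r \<le> n1 \<bullet> c y + n2 * F y" if "r < a - ?\<psi> u" "y \<in> D" for u r y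
  proof -
    have "(u, r) \<in> S" "(c y, F y) \<in> T" using that by (auto simp: S_def T_def)
    then show ?thesis 
      using bspec[OF n(2), of "(u, r)"] bspec[OF n(3), of "(c y, F y)"] by (simp add: n12)
  qed
  \<comment> \<open>The hypograph is unbounded below.\<close>
  have "n2 \<ge> 0"
  proof (rule ccontr)
    assume "\<not> n2 \<ge> 0"
    then have neg: "n2 < 0" by simp
    define M where "M = n1 \<bullet> c y0 + n2 * F y0"
    define r where "r = min (a - ?\<psi> 0 - 1) ((M + 1) / n2)"
    have "n2 * r \<le> M" using sep[of r 0 y0] y0 by (simp add: r_def M_def)
    moreover have "n2 * r \<ge> n2 * ((M + 1) / n2)"
      using neg by (intro mult_left_mono_neg) (auto simp: r_def)
    ultimately show False using neg by simp
  qed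
  \<comment> \<open>A vertical hyperplane would bound a nonzero linear form on the whole space,
    onto which the hypograph projects.\<close>
  moreover have "n2 \<noteq> 0"
  proof
    assume "n2 = 0"
    then have n1: "n1 \<noteq> 0" and "n1 \<bullet> u \<le> n1 \<bullet> c y0" for u
      using n n12 sep[of "a - ?\<psi> u - 1" u y0] y0 by (auto simp: zero_prod_def)
    from this(2)[of "c y0 + n1"] have "n1 \<bullet> n1 \<le> 0"
      by (simp add: inner_add_right)
    moreover have "0 < n1 \<bullet> n1" using n1 by simp
    ultimately show False by linarith
  qed
  ultimately have pos: "n2 > 0" by simp
  define q where "q = n1 /\<^sub>R n2"
  have key: "q \<bullet> u + (a - ?\<psi> u) \<le> q \<bullet> c y + F y" if "y \<in> D" for u y
  proof -
    have "a - ?\<psi> u \<le> q \<bullet> c y + F y - q \<bullet> u"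
    proof (rule dense_le)
      fix r assume "r < a - ?\<psi> u"
      moreover have "n1 = n2 *\<^sub>R q" using pos by (simp add: q_def)
      ultimately have "n2 * (q \<bullet> u + r) \<le> n2 * (q \<bullet> c y + F y)"
        using sep[of r u y] that by (simp add: distrib_left)
      then have "q \<bullet> u + r \<le> q \<bullet> c y + F y" using pos by simp
      then show "r \<le> q \<bullet> c y + F y - q \<bullet> u" by simp
    qed
    then show ?thesis by simp
  qed
  \<comment> \<open>Along a ray in \<open>- K\<close> the penalty stays nonpositive, so \<open>q\<close> cannot be positive on \<open>- K\<close>.\<close>
  have qK: "q \<in> dual_cone K"
    unfolding dual_cone_def
  proof (intro CollectI ballI, rule ccontr)
    fix s assume s: "s \<in> K" and "\<not> 0 \<le> s \<bullet> q"
    then have neg: "q \<bullet> s < 0" by (simp add: inner_commute)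
    define M where "M = q \<bullet> c y0 + F y0 - a"
    define t where "t = (\<bar>M\<bar> + 1) / (- (q \<bullet> s))"
    have t: "0 \<le> t" unfolding t_def using neg by (intro divide_nonneg_nonneg) auto
    then have "t *\<^sub>R s \<in> K" using s cone_K by (simp add: cone_def)
    from penalty_nonpos_on_polar[OF this, of v] key[OF y0, of "- (t *\<^sub>R s)"]
    have "t * (- (q \<bullet> s)) \<le> M" by (simp add: M_def)
    then show False using neg by (simp add: t_def split: abs_split)
  qed
  show ?thesis
  proof (rule that[OF qK])
    fix y assume y: "y \<in> D"
    show "a + (norm (q - v))\<^sup>2 / (2 * \<rho>) \<le> F y + q \<bullet> c y"
      using key[OF y, of "(q - v) /\<^sub>R \<rho>"] penalty_recentred[OF qK, of v] by simp
  qed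
qed

lemma dual_value_le_augmented:
  assumes "\<mu> \<in> dual_cone K" "y \<in> D"
  shows "dual_value \<mu> - (norm (\<mu> - v))\<^sup>2 / (2 * \<rho>) \<le> F y + penalty K \<rho> v (c y)"
  using penalty_ge[OF assms(1), of "c y" v] dual_value_le[OF assms] rho_pos
    divide_nonneg_pos[OF zero_le_power2, of "2 * \<rho>" "norm (\<mu> - multiplier_step K \<rho> v (c y))"]
  by linarith

lemma dual_value_concave:
  assumes "\<mu> \<in> dual_cone K" "\<nu> \<in> dual_cone K" "0 \<le> t" "t \<le> 1"
  shows "(1 - t) * dual_value \<mu> + t * dual_value \<nu> \<le> dual_value ((1 - t) *\<^sub>R \<mu> + t *\<^sub>R \<nu>)"
proof -
  have "(1 - t) *\<^sub>R \<mu> + t *\<^sub>R \<nu> \<in> dual_cone K"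
    using assms by (intro dual_cone_segment)
  then obtain y where y: "y \<in> D"
    "dual_value ((1 - t) *\<^sub>R \<mu> + t *\<^sub>R \<nu>) = F y + ((1 - t) *\<^sub>R \<mu> + t *\<^sub>R \<nu>) \<bullet> c y"
    by (metis dual_value_attained)
  have "(1 - t) * dual_value \<mu> + t * dual_value \<nu>
      \<le> (1 - t) * (F y + \<mu> \<bullet> c y) + t * (F y + \<nu> \<bullet> c y)"
    using assms y dual_value_le by (intro add_mono mult_left_mono) auto
  also have "\<dots> = F y + ((1 - t) *\<^sub>R \<mu> + t *\<^sub>R \<nu>) \<bullet> c y"
    by (simp add: inner_add_left algebra_simps)
  finally show ?thesis using y by simp
qed

text \<open>The proximal point \<open>p\<close> of the concave dual function at \<open>v\<close>, that is the maximizer of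
  \<open>dual_value \<mu> - (norm (\<mu> - v))\<^sup>2 / (2 * \<rho>)\<close>, described by its variational inequality:
  \<open>(p - v) / \<rho>\<close> is a supergradient of the dual function at \<open>p\<close>. In this form the strong concavity
  of the proximal objective is already built in.\<close>
definition dual_prox :: "'m \<Rightarrow> 'm \<Rightarrow> bool" where
  "dual_prox v p \<longleftrightarrow> p \<in> dual_cone K \<and>
     (\<forall>\<mu>\<in>dual_cone K. dual_value \<mu> \<le> dual_value p + (\<mu> - p) \<bullet> (p - v) / \<rho>)"

text \<open>The multiplier that certifies the infimum of the augmented Lagrangian is the proximal point. An
  approximate minimizer \<open>y\<close> leads to a multiplier step near \<open>p\<close>: its augmented value exceeds the
  infimum by at least \<open>(norm (step - p))\<^sup>2 / (2 * \<rho>)\<close>, which is the strong concavity gap in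
  \<open>penalty_ge\<close> at \<open>p\<close>.\<close>
lemma dual_prox_exists:
  obtains p where "dual_prox v p"
    "\<And>y \<epsilon>. y \<in> D \<Longrightarrow> (\<And>z. z \<in> D \<Longrightarrow> F y + penalty K \<rho> v (c y) \<le> F z + penalty K \<rho> v (c z) + \<epsilon>) \<Longrightarrow>
       (norm (multiplier_step K \<rho> v (c y) - p))\<^sup>2 \<le> 2 * \<rho> * \<epsilon>"
proof -
  let ?\<Phi> = "\<lambda>y. F y + penalty K \<rho> v (c y)"
  define a where "a = (INF y\<in>D. ?\<Phi> y)"
  have "bdd_below (?\<Phi> ` D)"
    using dual_value_le_augmented[OF zero_in_dual_cone, of _ v] by (auto intro!: bdd_belowI2)
  then have a_le: "a \<le> ?\<Phi> y" if "y \<in> D" for y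
    unfolding a_def using that by (rule cINF_lower)
  have a_ge: "m \<le> a" if "\<And>y. y \<in> D \<Longrightarrow> m \<le> ?\<Phi> y" for m
    unfolding a_def using D_nonempty that by (rule cINF_greatest)
  obtain p where p: "p \<in> dual_cone K"
    and p_le: "\<And>y. y \<in> D \<Longrightarrow> a + (norm (p - v))\<^sup>2 / (2 * \<rho>) \<le> F y + p \<bullet> c y"
    using augmented_duality[of a v] a_le by metis
  have "dual_prox v p"
    unfolding dual_prox_def
  proof (intro conjI ballI p)
    fix \<mu> assume \<mu>: "\<mu> \<in> dual_cone K"
    define X where "X = 2 * \<rho> * (dual_value \<mu> - dual_value p) - 2 * ((\<mu> - p) \<bullet> (p - v))"
    define Y where "Y = (norm (\<mu> - p))\<^sup>2"
    \<comment> \<open>First-order optimality of \<open>p\<close>: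
      move a fraction \<open>t\<close> towards \<open>\<mu>\<close>, divide by \<open>t\<close>, and let \<open>t\<close> tend to 0.\<close>
    have XY: "X \<le> t * Y" if t: "0 < t" "t \<le> 1" for t
    proof -
      let ?m = "(1 - t) *\<^sub>R p + t *\<^sub>R \<mu>"
      have m: "?m \<in> dual_cone K" using p \<mu> t by (intro dual_cone_segment) auto
      have "a + (norm (p - v))\<^sup>2 / (2 * \<rho>) \<le> dual_value p"
        using p_le dual_value_attained[OF p] by metis
      moreover have "dual_value ?m - (norm (?m - v))\<^sup>2 / (2 * \<rho>) \<le> a"
        using dual_value_le_augmented[OF m] by (intro a_ge)
      moreover have "(1 - t) * dual_value p + t * dual_value \<mu> \<le> dual_value ?m"
        using p \<mu> t by (intro dual_value_concave) auto
      ultimately have "(t * (dual_value \<mu> - dual_value p)) * (2 * \<rho>)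
          \<le> ((norm (?m - v))\<^sup>2 / (2 * \<rho>) - (norm (p - v))\<^sup>2 / (2 * \<rho>)) * (2 * \<rho>)"
        using rho_pos by (intro mult_right_mono) (auto simp: algebra_simps)
      also have "\<dots> = (norm (?m - v))\<^sup>2 - (norm (p - v))\<^sup>2"
        using rho_pos by (simp add: left_diff_distrib)
      also have "\<dots> = (norm (t *\<^sub>R (\<mu> - p)))\<^sup>2 + 2 * ((t *\<^sub>R (\<mu> - p)) \<bullet> (p - v))"
      proof -
        have "?m - p = t *\<^sub>R (\<mu> - p)" by (simp add: algebra_simps)
        then show ?thesis using norm_diff_three_points[of ?m v p] by simp
      qed
      also have "\<dots> = t * (t * Y + 2 * ((\<mu> - p) \<bullet> (p - v)))"
        by (simp add: Y_def power_mult_distrib power2_eq_square distrib_left mult.left_commute)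
      finally have "t * X \<le> t * (t * Y)"
        by (simp add: X_def algebra_simps)
      then show ?thesis using t by simp
    qed
    have "X \<le> 0"
    proof (rule ccontr)
      assume "\<not> X \<le> 0"
      then have X: "0 < X" by simp
      have Y: "0 \<le> Y" by (simp add: Y_def)
      define t where "t = min 1 (X / (Y + 1))"
      have t: "0 < t" "t \<le> 1" using X Y by (auto simp: t_def)
      have "t * (Y + 1) \<le> X / (Y + 1) * (Y + 1)"
        using Y by (intro mult_right_mono) (auto simp: t_def)
      then have "t * (Y + 1) \<le> X" using Y by simp
      with XY[OF t] t show False by (simp add: algebra_simps)
    qed
    then have "2 * \<rho> * (dual_value \<mu> - dual_value p) \<le> 2 * ((\<mu> - p) \<bullet> (p - v))"
      by (simp add: X_def)
    then show "dual_value \<mu> \<le> dual_value p + (\<mu> - p) \<bullet> (p - v) / \<rho>"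
      using rho_pos by (simp add: field_simps)
  qed
  moreover have "(norm (multiplier_step K \<rho> v (c y) - p))\<^sup>2 \<le> 2 * \<rho> * \<epsilon>"
    if y: "y \<in> D" and opt: "\<And>z. z \<in> D \<Longrightarrow> ?\<Phi> y \<le> ?\<Phi> z + \<epsilon>" for y \<epsilon>
  proof -
    have "?\<Phi> y - \<epsilon> \<le> a" using opt by (intro a_ge) (simp add: algebra_simps)
    moreover note p_le[OF y] penalty_ge[OF p, of "c y" v]
    ultimately have "(norm (p - multiplier_step K \<rho> v (c y)))\<^sup>2 / (2 * \<rho>) \<le> \<epsilon>"
      by linarith
    then show ?thesis using rho_pos by (simp add: field_simps norm_minus_commute)
  qed
  ultimately show ?thesis using that by blast
qed

lemma dual_prox_firmly_nonexpansive:
  assumes "dual_prox v p" "dual_prox w q"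
  shows "(norm (p - q))\<^sup>2 \<le> (p - q) \<bullet> (v - w)"
proof -
  have "dual_value q \<le> dual_value p + (q - p) \<bullet> (p - v) / \<rho>"
    "dual_value p \<le> dual_value q + (p - q) \<bullet> (q - w) / \<rho>"
    using assms by (auto simp: dual_prox_def)
  then have "0 \<le> (q - p) \<bullet> (p - v) / \<rho> + (p - q) \<bullet> (q - w) / \<rho>" by linarith
  then have "0 \<le> (q - p) \<bullet> (p - v) + (p - q) \<bullet> (q - w)"
    using rho_pos by (simp add: zero_le_divide_iff flip: add_divide_distrib)
  then show ?thesis
    by (simp add: power2_norm_eq_inner inner_diff_left inner_diff_right inner_commute)
qed

text \<open>Firm nonexpansiveness makes both the proximal map and its displacement map nonexpansive. The first
  controls the distance of the multipliers to a dual solution, the second the length of a step.\<close>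
lemma dual_prox_nonexpansive:
  assumes "dual_prox v p" "dual_prox w q"
  shows "norm (p - q) \<le> norm (v - w)" and "norm ((p - v) - (q - w)) \<le> norm (v - w)"
proof -
  note firm = dual_prox_firmly_nonexpansive[OF assms]
  have "norm (p - q) * norm (p - q) \<le> norm (p - q) * norm (v - w)"
    using firm norm_cauchy_schwarz[of "p - q" "v - w"] by (simp add: power2_eq_square)
  then show "norm (p - q) \<le> norm (v - w)"
    by (cases "p = q") auto
  have "(norm ((p - v) - (q - w)))\<^sup>2 = (norm (p - q))\<^sup>2 - 2 * ((p - q) \<bullet> (v - w)) + (norm (v - w))\<^sup>2"
    by (simp add: power2_norm_eq_inner inner_diff_left inner_diff_right inner_commute)
  also have "\<dots> \<le> (norm (v - w))\<^sup>2" using firm zero_le_power2[of "norm (p - q)"] by linarith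
  finally show "norm ((p - v) - (q - w)) \<le> norm (v - w)"
    by (rule power2_le_imp_le) simp
qed

end

section \<open>Perturbed convex programs\<close>

text \<open>
  A reference program \<open>(Fs, cs)\<close> with dual solution \<open>lams\<close>, and a program \<open>(F, c)\<close> at parameter
  distance \<open>\<delta>\<close>. Constraint values at Lagrangian minimizers are supergradients of the dual
  functions, so \<open>minimizers_close\<close> says that each supergradient of this kind of the perturbed dual
  function is within \<open>g \<mu> * \<delta>\<close> of one of the reference dual function, but not conversely.\<close>
locale perturbed_program =
  ref: cone_program K \<rho> D Fs cs + pert: cone_program K \<rho> D F c
  for K :: "'m::euclidean_space set" and \<rho> :: real and D :: "'x::real_vector set"
    and Fs F :: "'x \<Rightarrow> real" and cs c :: "'x \<Rightarrow> 'm" +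
  fixes lams :: 'm and g :: "'m \<Rightarrow> real" and \<delta> \<phi> \<epsilon> :: real
  assumes lams_in: "lams \<in> dual_cone K"
    and lams_opt: "\<And>\<mu>. \<mu> \<in> dual_cone K \<Longrightarrow> ref.dual_value \<mu> \<le> ref.dual_value lams"
    and g_cont: "continuous_on (dual_cone K) g"
    and minimizers_close: "\<And>\<mu> y. \<mu> \<in> dual_cone K \<Longrightarrow> y \<in> D \<Longrightarrow>
      (\<And>z. z \<in> D \<Longrightarrow> F y + \<mu> \<bullet> c y \<le> F z + \<mu> \<bullet> c z) \<Longrightarrow>
      \<exists>y'\<in>D. (\<forall>z\<in>D. Fs y' + \<mu> \<bullet> cs y' \<le> Fs z + \<mu> \<bullet> cs z) \<and> norm (c y - cs y') \<le> g \<mu> * \<delta>"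
    and F_close: "\<And>y. y \<in> D \<Longrightarrow> \<bar>F y - Fs y\<bar> \<le> \<phi>"
    and c_close: "\<And>y. y \<in> D \<Longrightarrow> norm (c y - cs y) \<le> \<epsilon>"
begin

text \<open>For the reference program \<open>lams\<close> is its own proximal point; the lemma bounds how far the
  perturbation moves it. The supergradient 0 of the reference dual function at \<open>lams\<close> may have no
  perturbed supergradient at \<open>lams\<close> within reach of \<open>minimizers_close\<close>, because that inclusion
  goes the other way. On the open segment from \<open>lams\<close> to the proximal point \<open>p\<close> it suffices,
  however: with \<open>d = p - lams\<close>, the slope of the perturbed dual function along \<open>d\<close> is at least
  \<open>(norm d)\<^sup>2 / \<rho>\<close> there, while some reference slope close to it is at most 0. Letting the point
  tend to \<open>lams\<close> replaces the modulus \<open>g\<close> by its value at \<open>lams\<close>.\<close>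
lemma dual_prox_perturbation:
  assumes p: "pert.dual_prox lams p"
  shows "norm (p - lams) \<le> \<rho> * g lams * \<delta>"
proof (cases "p = lams")
  case True
  obtain y where "y \<in> D" "\<And>z. z \<in> D \<Longrightarrow> F y + lams \<bullet> c y \<le> F z + lams \<bullet> c z"
    using pert.dual_value_attained[OF lams_in] by metis
  from minimizers_close[OF lams_in this] have "0 \<le> g lams * \<delta>"
    using norm_ge_zero order_trans by blast
  then show ?thesis using True ref.rho_pos by (simp add: mult.assoc)
next
  case False
  define d where "d = p - lams"
  have pK: "p \<in> dual_cone K" using p by (simp add: pert.dual_prox_def)
  have seg: "lams + t *\<^sub>R d \<in> dual_cone K" if "0 \<le> t" "t \<le> 1" for t
  proof -
    have "lams + t *\<^sub>R d = (1 - t) *\<^sub>R lams + t *\<^sub>R p" by (simp add: d_def algebra_simps)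
    then show ?thesis using lams_in pK that by (simp add: dual_cone_segment)
  qed
  have bound: "norm d \<le> \<rho> * g (lams + t *\<^sub>R d) * \<delta>" if t: "0 < t" "t < 1" for t
  proof -
    let ?m = "lams + t *\<^sub>R d"
    have m: "?m \<in> dual_cone K" using seg t by simp
    obtain y where y: "y \<in> D" "pert.dual_value ?m = F y + ?m \<bullet> c y"
      and y_min: "\<And>z. z \<in> D \<Longrightarrow> F y + ?m \<bullet> c y \<le> F z + ?m \<bullet> c z"
      using pert.dual_value_attained[OF m] by metis
    obtain y' where y': "y' \<in> D" "\<And>z. z \<in> D \<Longrightarrow> Fs y' + ?m \<bullet> cs y' \<le> Fs z + ?m \<bullet> cs z"
      and close: "norm (c y - cs y') \<le> g ?m * \<delta>"
      using minimizers_close[OF m y(1) y_min] by blast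
    have "pert.dual_value ?m \<le> pert.dual_value p + (?m - p) \<bullet> (p - lams) / \<rho>"
      using p m by (simp add: pert.dual_prox_def)
    also have "pert.dual_value p \<le> F y + p \<bullet> c y"
      by (rule pert.dual_value_le[OF pK y(1)])
    finally have "(p - ?m) \<bullet> c y \<ge> (p - ?m) \<bullet> d / \<rho>"
      using y(2) by (simp add: inner_diff_left d_def diff_divide_distrib)
    moreover have "p - ?m = (1 - t) *\<^sub>R d" by (simp add: d_def algebra_simps)
    ultimately have "(1 - t) * (d \<bullet> d / \<rho>) \<le> (1 - t) * (d \<bullet> c y)" by simp
    then have up: "d \<bullet> d / \<rho> \<le> d \<bullet> c y" by (rule mult_left_le_imp_le) (use t in simp)
    have "ref.dual_value lams \<le> Fs y' + lams \<bullet> cs y'"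
      by (rule ref.dual_value_le[OF lams_in y'(1)])
    moreover have "Fs y' + ?m \<bullet> cs y' \<le> ref.dual_value ?m"
      using ref.dual_value_attained[OF m] y'(2) by metis
    ultimately have "t * (d \<bullet> cs y') \<le> 0"
      using lams_opt[OF m] by (simp add: inner_add_left)
    then have "d \<bullet> cs y' \<le> 0" using t by (simp add: mult_le_0_iff)
    with up have "d \<bullet> d / \<rho> \<le> d \<bullet> (c y - cs y')" by (simp add: inner_diff_right)
    also have "\<dots> \<le> norm d * norm (c y - cs y')" by (rule norm_cauchy_schwarz)
    also have "\<dots> \<le> norm d * (g ?m * \<delta>)" using close by (intro mult_left_mono) auto
    finally have "norm d * norm d \<le> norm d * (\<rho> * g ?m * \<delta>)"
      using ref.rho_pos by (simp add: field_simps power2_norm_eq_inner flip: power2_eq_square)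
    then show ?thesis using False by (simp add: d_def)
  qed
  have "((\<lambda>t. lams + t *\<^sub>R d) \<longlongrightarrow> lams + 0 *\<^sub>R d) (at_right (0::real))"
    by (intro tendsto_intros)
  then have "((\<lambda>t. g (lams + t *\<^sub>R d)) \<longlongrightarrow> g lams) (at_right (0::real))"
  proof (intro continuous_on_tendsto_compose[OF g_cont _ lams_in])
    show "\<forall>\<^sub>F t in at_right (0::real). lams + t *\<^sub>R d \<in> dual_cone K"
      using seg by (auto simp: eventually_at_right_field intro!: exI[of _ 1])
  qed simp
  then have "((\<lambda>t. \<rho> * g (lams + t *\<^sub>R d) * \<delta>) \<longlongrightarrow> \<rho> * g lams * \<delta>) (at_right (0::real))"
    by (intro tendsto_intros)
  then have "norm d \<le> \<rho> * g lams * \<delta>"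
  proof (rule tendsto_lowerbound)
    show "\<forall>\<^sub>F t in at_right (0::real). norm d \<le> \<rho> * g (lams + t *\<^sub>R d) * \<delta>"
      using bound by (auto simp: eventually_at_right_field intro!: exI[of _ 1])
  qed simp
  then show ?thesis by (simp add: d_def)
qed

context
  fixes v :: 'm and y :: 'x and \<alpha> :: real
  assumes y_in: "y \<in> D"
    and y_opt: "\<And>z. z \<in> D \<Longrightarrow> F y + penalty K \<rho> v (c y) \<le> F z + penalty K \<rho> v (c z) + \<alpha>"
begin

text \<open>Compare with the exact perturbed proximal points at \<open>v\<close> and at \<open>lams\<close>: the error is the
  inexactness, a nonexpansive term, and the perturbation of the reference fixed point \<open>lams\<close>. The same
  argument for displacements bounds the length of the step, because the displacement of the fixed point
  is itself only a perturbation term.\<close>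
lemma inexact_step_bounds:
  defines "v' \<equiv> multiplier_step K \<rho> v (c y)"
  shows "norm (v' - lams) \<le> norm (v - lams) + sqrt (2 * \<rho> * \<alpha>) + \<rho> * g lams * \<delta>"
    and "norm (v' - v) \<le> norm (v - lams) + sqrt (2 * \<rho> * \<alpha>) + \<rho> * g lams * \<delta>"
proof -
  obtain p where p: "pert.dual_prox v p"
    and "(norm (v' - p))\<^sup>2 \<le> 2 * \<rho> * \<alpha>"
    using pert.dual_prox_exists[of v] y_in y_opt unfolding v'_def by metis
  then have vp: "norm (v' - p) \<le> sqrt (2 * \<rho> * \<alpha>)" by (intro real_le_rsqrt)
  obtain q where q: "pert.dual_prox lams q"
    using pert.dual_prox_exists[of lams] by metis
  note q_close = dual_prox_perturbation[OF q]
  have "norm (v' - lams) \<le> norm (v' - p) + norm (p - q) + norm (q - lams)"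
    using norm_triangle_ineq[of "v' - p" "p - q"] norm_triangle_ineq[of "v' - q" "q - lams"] by simp
  with vp q_close pert.dual_prox_nonexpansive(1)[OF p q]
  show "norm (v' - lams) \<le> norm (v - lams) + sqrt (2 * \<rho> * \<alpha>) + \<rho> * g lams * \<delta>" by simp
  have "norm (v' - v) \<le> norm (v' - p) + norm (p - v - (q - lams)) + norm (q - lams)"
    using norm_triangle_ineq[of "v' - p" "p - v"] norm_triangle_ineq[of "p - v - (q - lams)" "q - lams"]
    by simp
  with vp q_close pert.dual_prox_nonexpansive(2)[OF p q]
  show "norm (v' - v) \<le> norm (v - lams) + sqrt (2 * \<rho> * \<alpha>) + \<rho> * g lams * \<delta>" by simp
qed

text \<open>A point \<open>z\<close> feasible for the reference program violates the perturbed constraint by at most \<open>\<epsilon>\<close>,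
  which bounds its penalty, while the penalty of \<open>y\<close> is a difference of squared norms of
  consecutive multipliers and telescopes along the iteration.\<close>
lemma inexact_step_objective:
  assumes z: "z \<in> D" "- cs z \<in> K"
  shows "Fs y - Fs z \<le> \<alpha> + ((norm v)\<^sup>2 - (norm (multiplier_step K \<rho> v (c y)))\<^sup>2) / (2 * \<rho>)
           + norm v * \<epsilon> + \<rho> / 2 * \<epsilon>\<^sup>2 + 2 * \<phi>"
proof -
  define e where "e = c z - cs z"
  have e: "norm e \<le> \<epsilon>" unfolding e_def by (rule c_close[OF z(1)])
  have "cs z \<in> uminus ` K" using z(2) by (metis imageI minus_minus)
  then have "infdist (c z + v /\<^sub>R \<rho>) (uminus ` K) \<le> dist (c z + v /\<^sub>R \<rho>) (cs z)"
    by (rule infdist_le)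
  then have "infdist (c z + v /\<^sub>R \<rho>) (uminus ` K) \<le> norm (e + v /\<^sub>R \<rho>)"
    by (simp add: dist_norm e_def algebra_simps)
  then have "(infdist (c z + v /\<^sub>R \<rho>) (uminus ` K))\<^sup>2 \<le> (norm (e + v /\<^sub>R \<rho>))\<^sup>2"
    by (intro power_mono) (auto simp: infdist_nonneg)
  then have "penalty K \<rho> v (c z) \<le> \<rho> / 2 * (norm (e + v /\<^sub>R \<rho>))\<^sup>2 - (norm v)\<^sup>2 / (2 * \<rho>)"
    unfolding penalty_def using ref.rho_pos by (intro diff_mono mult_left_mono) auto
  also have "\<dots> = e \<bullet> v + \<rho> / 2 * (norm e)\<^sup>2"
    using ref.rho_pos
    by (simp add: power2_norm_eq_inner inner_add_left inner_add_right inner_commute field_simps)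
  also have "\<dots> \<le> norm v * \<epsilon> + \<rho> / 2 * \<epsilon>\<^sup>2"
  proof (rule add_mono)
    have "e \<bullet> v \<le> norm e * norm v" by (rule norm_cauchy_schwarz)
    also have "\<dots> \<le> \<epsilon> * norm v" using e by (intro mult_right_mono) auto
    finally show "e \<bullet> v \<le> norm v * \<epsilon>" by (simp add: mult.commute)
    show "\<rho> / 2 * (norm e)\<^sup>2 \<le> \<rho> / 2 * \<epsilon>\<^sup>2"
      using e ref.rho_pos by (intro mult_left_mono power_mono) auto
  qed
  finally have "penalty K \<rho> v (c z) \<le> norm v * \<epsilon> + \<rho> / 2 * \<epsilon>\<^sup>2" .
  moreover have "((norm v)\<^sup>2 - (norm (multiplier_step K \<rho> v (c y)))\<^sup>2) / (2 * \<rho>) = - penalty K \<rho> v (c y)"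
    by (simp add: ref.penalty_eq_norm_step diff_divide_distrib)
  ultimately show ?thesis
    using y_opt[OF z(1)] F_close[OF z(1)] F_close[OF y_in] by linarith
qed

lemma inexact_step_constraint:
  "\<rho> * (lams \<bullet> cs y) \<le> lams \<bullet> (multiplier_step K \<rho> v (c y) - v) + \<rho> * (norm lams * \<epsilon>)"
proof -
  have "lams \<bullet> (cs y - c y) \<le> norm lams * norm (cs y - c y)" by (rule norm_cauchy_schwarz)
  also have "\<dots> \<le> norm lams * \<epsilon>"
    using c_close[OF y_in] by (intro mult_left_mono) (auto simp: norm_minus_commute)
  finally have "\<rho> * (lams \<bullet> (cs y - c y)) \<le> \<rho> * (norm lams * \<epsilon>)"
    using ref.rho_pos by simp
  then show ?thesis
    using ref.inner_constraint_le_step[OF lams_in, of "c y" v]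
    by (simp add: inner_diff_right right_diff_distrib)
qed

end

end

section \<open>Geometrically vanishing perturbations\<close>

text \<open>The sign condition is on \<open>c * \<delta> 0\<close> because Lipschitz moduli may be negative when
  all perturbations vanish.\<close>
lemma sum_le_geometric:
  fixes \<delta> :: "nat \<Rightarrow> real"
  assumes rate: "\<And>i. \<delta> i \<le> \<tau> ^ i * \<delta> 0" and nonneg: "\<And>i. 0 \<le> \<delta> i"
    and \<tau>: "0 < \<tau>" "\<tau> < 1" and c: "0 \<le> c * \<delta> 0"
  shows "(\<Sum>i<k. c * \<delta> i) \<le> c * (\<delta> 0 / (1 - \<tau>))"
proof -
  have term_le: "c * \<delta> i \<le> c * \<delta> 0 * \<tau> ^ i" for i
  proof (cases "\<delta> 0 = 0")
    case True
    then show ?thesis using rate[of i] nonneg[of i] by simp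
  next
    case False
    then have "0 \<le> c" using c nonneg[of 0] by (simp add: zero_le_mult_iff)
    from mult_left_mono[OF rate[of i] this] show ?thesis by (simp add: mult_ac)
  qed
  have "(\<Sum>i<k. c * \<delta> i) \<le> (\<Sum>i<k. c * \<delta> 0 * \<tau> ^ i)" by (rule sum_mono) (rule term_le)
  also have "\<dots> = c * \<delta> 0 * (\<Sum>i<k. \<tau> ^ i)" by (simp add: sum_distrib_left)
  also have "\<dots> \<le> c * \<delta> 0 * (1 / (1 - \<tau>))"
  proof (rule mult_left_mono[OF _ c])
    have "(\<Sum>i<k. \<tau> ^ i) \<le> (\<Sum>i. \<tau> ^ i)"
      using \<tau> by (intro sum_le_suminf summable_geometric) auto
    then show "(\<Sum>i<k. \<tau> ^ i) \<le> 1 / (1 - \<tau>)" using \<tau> by (simp add: suminf_geometric)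
  qed
  finally show ?thesis by simp
qed

lemma summable_of_summable_sqrt:
  fixes \<alpha> :: "nat \<Rightarrow> real"
  assumes "summable (\<lambda>i. sqrt (\<alpha> i))" and nonneg: "\<And>i. 0 \<le> \<alpha> i"
  shows "summable \<alpha>"
proof (rule summable_comparison_test_ev[OF _ assms(1)])
  have "\<forall>\<^sub>F i in sequentially. sqrt (\<alpha> i) < 1"
    using summable_LIMSEQ_zero[OF assms(1)] by (rule order_tendstoD) simp
  then show "\<forall>\<^sub>F i in sequentially. norm (\<alpha> i) \<le> sqrt (\<alpha> i)"
  proof eventually_elim
    case (elim i)
    then have "sqrt (\<alpha> i) * sqrt (\<alpha> i) \<le> sqrt (\<alpha> i) * 1"
      using nonneg[of i] by (intro mult_left_mono) auto
    then show ?case using nonneg[of i] by simp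
  qed
qed

text \<open>The inexact method, with the \<open>i\<close>-th step taken on a program at parameter distance \<open>\<delta> i\<close> from the
  reference program.\<close>
locale perturbed_multiplier_method =
  fixes K :: "'m::euclidean_space set" and \<rho> :: real and D :: "'x::real_vector set"
    and Fs :: "'x \<Rightarrow> real" and F :: "nat \<Rightarrow> 'x \<Rightarrow> real"
    and cs :: "'x \<Rightarrow> 'm" and c :: "nat \<Rightarrow> 'x \<Rightarrow> 'm"
    and lams :: 'm and g :: "'m \<Rightarrow> real" and \<delta> :: "nat \<Rightarrow> real" and Lf Lh \<tau> :: real
    and \<alpha> :: "nat \<Rightarrow> real" and x :: "nat \<Rightarrow> 'x" and lam :: "nat \<Rightarrow> 'm"
  assumes perturbed: "\<And>i. perturbed_program K \<rho> D Fs (F i) cs (c i) lams g (\<delta> i) (Lf * \<delta> i) (Lh * \<delta> i)"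
    and delta_nonneg: "\<And>i. 0 \<le> \<delta> i"
    and delta_rate: "\<And>i. \<delta> i \<le> \<tau> ^ i * \<delta> 0"
    and tau: "0 < \<tau>" "\<tau> < 1"
    and alpha_nonneg: "\<And>i. 0 \<le> \<alpha> i"
    and sqrt_alpha_summable: "summable (\<lambda>i. sqrt (\<alpha> i))"
    and x_in: "\<And>i. x (Suc i) \<in> D"
    and x_opt: "\<And>i z. z \<in> D \<Longrightarrow> F i (x (Suc i)) + penalty K \<rho> (lam i) (c i (x (Suc i)))
        \<le> F i z + penalty K \<rho> (lam i) (c i z) + \<alpha> i"
    and lam_step: "\<And>i. lam (Suc i) = multiplier_step K \<rho> (lam i) (c i (x (Suc i)))"
begin

sublocale penalty_cone K \<rho>
  using perturbed[of 0] by (simp add: perturbed_program_def cone_program_def)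

lemma nonneg_moduli: "0 \<le> Lf * \<delta> i" "0 \<le> Lh * \<delta> i" "\<mu> \<in> dual_cone K \<Longrightarrow> 0 \<le> g \<mu> * \<delta> i"
proof -
  interpret perturbed_program K \<rho> D Fs "F i" cs "c i" lams g "\<delta> i" "Lf * \<delta> i" "Lh * \<delta> i"
    by (rule perturbed)
  show "0 \<le> Lf * \<delta> i" using F_close[OF x_in[of 0]] abs_ge_zero order_trans by blast
  show "0 \<le> Lh * \<delta> i" using c_close[OF x_in[of 0]] norm_ge_zero order_trans by blast
  show "0 \<le> g \<mu> * \<delta> i" if \<mu>: "\<mu> \<in> dual_cone K"
  proof -
    obtain y where "y \<in> D" "\<And>z. z \<in> D \<Longrightarrow> F i y + \<mu> \<bullet> c i y \<le> F i z + \<mu> \<bullet> c i z"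
      using pert.dual_value_attained[OF \<mu>] by metis
    from minimizers_close[OF \<mu> this] show ?thesis using norm_ge_zero order_trans by blast
  qed
qed

text \<open>The radius of a ball around the dual solution that contains all multipliers.\<close>
definition radius :: real where
  "radius = sqrt (2 * \<rho>) * (\<Sum>i. sqrt (\<alpha> i)) + \<rho> * g lams * (\<delta> 0 / (1 - \<tau>)) + norm (lam 0 - lams)"

lemma lams_in: "lams \<in> dual_cone K"
  using perturbed_program.lams_in[OF perturbed] .

lemma step_error_sum:
  "(\<Sum>i<k. sqrt (2 * \<rho> * \<alpha> i) + \<rho> * g lams * \<delta> i) \<le> radius - norm (lam 0 - lams)"
proof -
  have "(\<Sum>i<k. sqrt (2 * \<rho> * \<alpha> i)) = sqrt (2 * \<rho>) * (\<Sum>i<k. sqrt (\<alpha> i))"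
    by (simp add: real_sqrt_mult sum_distrib_left)
  also have "\<dots> \<le> sqrt (2 * \<rho>) * (\<Sum>i. sqrt (\<alpha> i))"
    using rho_pos alpha_nonneg sqrt_alpha_summable by (intro mult_left_mono sum_le_suminf) auto
  finally have "(\<Sum>i<k. sqrt (2 * \<rho> * \<alpha> i)) \<le> sqrt (2 * \<rho>) * (\<Sum>i. sqrt (\<alpha> i))" .
  moreover have "(\<Sum>i<k. \<rho> * g lams * \<delta> i) \<le> \<rho> * g lams * (\<delta> 0 / (1 - \<tau>))"
    using nonneg_moduli(3)[OF lams_in, of 0] rho_pos
    by (intro sum_le_geometric delta_rate delta_nonneg tau) (simp add: mult.assoc)
  ultimately show ?thesis by (simp add: radius_def sum.distrib)
qed

lemma multiplier_distance: "norm (lam k - lams) \<le> radius"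
proof -
  have "norm (lam k - lams)
      \<le> norm (lam 0 - lams) + (\<Sum>i<k. sqrt (2 * \<rho> * \<alpha> i) + \<rho> * g lams * \<delta> i)"
  proof (induction k)
    case (Suc k)
    with perturbed_program.inexact_step_bounds(1)[OF perturbed x_in x_opt, of k]
    show ?case by (simp add: lam_step)
  qed simp
  with step_error_sum[of k] show ?thesis by simp
qed

lemma first_step_length: "norm (lam 1 - lam 0) \<le> radius"
  using perturbed_program.inexact_step_bounds(2)[OF perturbed x_in x_opt, of 0] step_error_sum[of 1]
  by (simp add: lam_step)

lemma objective_sum_le:
  assumes z: "z \<in> D" "- cs z \<in> K"
  shows "(\<Sum>i<k. Fs (x (Suc i)) - Fs z) \<le> (\<Sum>i. \<alpha> i) + 1 / (2 * \<rho>) * (norm (lam 0))\<^sup>2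
           + \<rho> / 2 * Lh\<^sup>2 * ((\<delta> 0)\<^sup>2 / (1 - \<tau>\<^sup>2))
           + ((radius + norm lams) * Lh + 2 * Lf) * (\<delta> 0 / (1 - \<tau>))"
proof -
  define C where "C = radius + norm lams"
  have C: "norm (lam i) \<le> C" for i
    using multiplier_distance[of i] norm_triangle_ineq[of "lam i - lams" lams] by (simp add: C_def)
  have C0: "0 \<le> C" using C[of 0] norm_ge_zero order_trans by blast
  have step: "Fs (x (Suc i)) - Fs z \<le> \<alpha> i + ((norm (lam i))\<^sup>2 - (norm (lam (Suc i)))\<^sup>2) / (2 * \<rho>)
      + \<rho> / 2 * Lh\<^sup>2 * (\<delta> i)\<^sup>2 + (C * Lh + 2 * Lf) * \<delta> i" for i
  proof -
    have "norm (lam i) * (Lh * \<delta> i) \<le> C * (Lh * \<delta> i)"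
      using C nonneg_moduli(2) by (intro mult_right_mono)
    with perturbed_program.inexact_step_objective[OF perturbed x_in x_opt z, of i]
    show ?thesis by (simp add: lam_step power_mult_distrib distrib_right)
  qed
  have "(\<Sum>i<k. Fs (x (Suc i)) - Fs z) \<le> (\<Sum>i<k. \<alpha> i + ((norm (lam i))\<^sup>2 - (norm (lam (Suc i)))\<^sup>2) / (2 * \<rho>)
      + \<rho> / 2 * Lh\<^sup>2 * (\<delta> i)\<^sup>2 + (C * Lh + 2 * Lf) * \<delta> i)"
    by (rule sum_mono) (rule step)
  also have "\<dots> = (\<Sum>i<k. \<alpha> i) + (\<Sum>i<k. (norm (lam i))\<^sup>2 - (norm (lam (Suc i)))\<^sup>2) / (2 * \<rho>)
      + (\<Sum>i<k. \<rho> / 2 * Lh\<^sup>2 * (\<delta> i)\<^sup>2) + (\<Sum>i<k. (C * Lh + 2 * Lf) * \<delta> i)"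
    by (simp only: sum.distrib sum_divide_distrib)
  also have "\<dots> \<le> (\<Sum>i. \<alpha> i) + 1 / (2 * \<rho>) * (norm (lam 0))\<^sup>2
      + \<rho> / 2 * Lh\<^sup>2 * ((\<delta> 0)\<^sup>2 / (1 - \<tau>\<^sup>2)) + (C * Lh + 2 * Lf) * (\<delta> 0 / (1 - \<tau>))"
  proof (intro add_mono)
    show "(\<Sum>i<k. \<alpha> i) \<le> (\<Sum>i. \<alpha> i)"
      using alpha_nonneg summable_of_summable_sqrt[OF sqrt_alpha_summable]
      by (intro sum_le_suminf) auto
    have "(\<Sum>i<k. (norm (lam i))\<^sup>2 - (norm (lam (Suc i)))\<^sup>2) = (norm (lam 0))\<^sup>2 - (norm (lam k))\<^sup>2"
      by (rule sum_lessThan_telescope')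
    also have "\<dots> \<le> (norm (lam 0))\<^sup>2" by simp
    finally show "(\<Sum>i<k. (norm (lam i))\<^sup>2 - (norm (lam (Suc i)))\<^sup>2) / (2 * \<rho>)
        \<le> 1 / (2 * \<rho>) * (norm (lam 0))\<^sup>2"
      using rho_pos by (simp add: divide_right_mono)
    have "\<tau>\<^sup>2 < 1" using tau by (simp add: power_less_one_iff abs_square_less_1)
    moreover have "(\<delta> i)\<^sup>2 \<le> (\<tau>\<^sup>2) ^ i * (\<delta> 0)\<^sup>2" for i
      using power_mono[OF delta_rate delta_nonneg, of i 2]
      by (simp add: power_mult_distrib mult.commute flip: power_mult)
    ultimately show "(\<Sum>i<k. \<rho> / 2 * Lh\<^sup>2 * (\<delta> i)\<^sup>2) \<le> \<rho> / 2 * Lh\<^sup>2 * ((\<delta> 0)\<^sup>2 / (1 - \<tau>\<^sup>2))"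
      using rho_pos tau by (intro sum_le_geometric[where \<delta> = "\<lambda>i. (\<delta> i)\<^sup>2"]) auto
    have "(C * Lh + 2 * Lf) * \<delta> 0 = C * (Lh * \<delta> 0) + 2 * (Lf * \<delta> 0)" by (simp add: distrib_right)
    then show "(\<Sum>i<k. (C * Lh + 2 * Lf) * \<delta> i) \<le> (C * Lh + 2 * Lf) * (\<delta> 0 / (1 - \<tau>))"
      using C0 nonneg_moduli(1,2)[of 0]
      by (intro sum_le_geometric delta_rate delta_nonneg tau) auto
  qed
  finally show ?thesis by (simp add: C_def)
qed

lemma constraint_sum_le:
  "(\<Sum>i<k. lams \<bullet> cs (x (Suc i))) \<le> norm lams * (norm (lam k - lam 0) / \<rho> + Lh * (\<delta> 0 / (1 - \<tau>)))"
proof -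
  have "lams \<bullet> cs (x (Suc i)) \<le> lams \<bullet> (lam (Suc i) - lam i) / \<rho> + norm lams * (Lh * \<delta> i)" for i
    using perturbed_program.inexact_step_constraint[OF perturbed x_in x_opt, of i] rho_pos
    by (simp add: lam_step field_simps)
  then have "(\<Sum>i<k. lams \<bullet> cs (x (Suc i)))
      \<le> (\<Sum>i<k. lams \<bullet> (lam (Suc i) - lam i) / \<rho> + norm lams * (Lh * \<delta> i))"
    by (intro sum_mono)
  also have "\<dots> = lams \<bullet> (\<Sum>i<k. lam (Suc i) - lam i) / \<rho> + norm lams * (\<Sum>i<k. Lh * \<delta> i)"
    by (simp only: sum.distrib inner_sum_right sum_divide_distrib sum_distrib_left)
  also have "(\<Sum>i<k. lam (Suc i) - lam i) = lam k - lam 0" by (rule sum_lessThan_telescope)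
  also have "lams \<bullet> (lam k - lam 0) / \<rho> + norm lams * (\<Sum>i<k. Lh * \<delta> i)
      \<le> norm lams * norm (lam k - lam 0) / \<rho> + norm lams * (Lh * (\<delta> 0 / (1 - \<tau>)))"
    using rho_pos nonneg_moduli(2)
    by (intro add_mono divide_right_mono norm_cauchy_schwarz mult_left_mono sum_le_geometric
        delta_rate delta_nonneg tau) auto
  finally show ?thesis by (simp add: distrib_left)
qed

text \<open>The triangle inequality through \<open>lams\<close> and \<open>a + r \<le> sqrt (2 * (a\<^sup>2 + r\<^sup>2))\<close> suffice from the second
  step on. For the first step they lose a factor \<open>sqrt 2\<close>, and \<open>first_step_length\<close> is used.\<close>
lemma multiplier_displacement:
  assumes k: "1 \<le> k"
  shows "norm (lam k - lam 0) \<le> sqrt (real k) * sqrt ((norm (lam 0 - lams))\<^sup>2 + radius\<^sup>2)"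
proof (cases "k = 1")
  case True
  have "radius \<le> sqrt ((norm (lam 0 - lams))\<^sup>2 + radius\<^sup>2)" by (intro real_le_rsqrt) simp
  with first_step_length have "norm (lam 1 - lam 0) \<le> sqrt ((norm (lam 0 - lams))\<^sup>2 + radius\<^sup>2)"
    by (rule order_trans)
  then show ?thesis using True by simp
next
  case False
  let ?a = "norm (lam 0 - lams)"
  have "norm (lam k - lam 0) \<le> norm (lam k - lams) + ?a"
    using norm_triangle_ineq4[of "lam k - lams" "lam 0 - lams"] by simp
  also have "\<dots> \<le> radius + ?a" using multiplier_distance[of k] by simp
  also have "\<dots> \<le> sqrt (2 * (?a\<^sup>2 + radius\<^sup>2))"
  proof (rule real_le_rsqrt)
    have "0 \<le> (radius - ?a)\<^sup>2" by simp
    then show "(radius + ?a)\<^sup>2 \<le> 2 * (?a\<^sup>2 + radius\<^sup>2)" by (simp add: power2_eq_square algebra_simps)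
  qed
  also have "\<dots> \<le> sqrt (real k * (?a\<^sup>2 + radius\<^sup>2))"
    using k False by (intro real_sqrt_le_mono mult_right_mono) auto
  finally show ?thesis by (simp add: real_sqrt_mult)
qed

end

section \<open>The iteration at the level of extended-valued data\<close>

lemma norm_le_spectral_norm: "norm (M *v y) \<le> spectral_norm M * norm y"
  unfolding spectral_norm_def by (rule onorm[OF matrix_vector_mul_bounded_linear])

lemma spectral_norm_nonneg: "0 \<le> spectral_norm M"
  unfolding spectral_norm_def by (rule onorm_pos_le[OF matrix_vector_mul_bounded_linear])

text \<open>The proof restricts everything to the common effective domain \<open>D\<close> of the functions \<open>f(\<cdot>;\<eta>)\<close>.
  There all functions are real valued, and the estimates for the perturbed method apply.\<close>
theorem theorem6:
  fixes X :: "(real^'n) set" and \<Theta> :: "(real^'d) set" and K :: "(real^'m) set"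
    and f :: "real^'n \<Rightarrow> real^'d \<Rightarrow> ereal"
    and h :: "real^'n \<Rightarrow> real^'d \<Rightarrow> real^'m"
    and A :: "real^'d \<Rightarrow> real^'n^'m" and b :: "real^'d \<Rightarrow> real^'m"
    and \<kappa> :: "real^'m \<Rightarrow> real"
    and \<theta>s :: "real^'d" and \<theta> :: "nat \<Rightarrow> real^'d"
    and x :: "nat \<Rightarrow> real^'n" and lam :: "nat \<Rightarrow> real^'m" and lams :: "real^'m"
    and \<alpha> :: "nat \<Rightarrow> real"
    and xbar :: "nat \<Rightarrow> real^'n" and fs :: ereal
    and \<rho> \<tau> LA Lb Lf Dx Lh Lhx U Cbar C1 C2 Bg Clam \<kappa>bar :: real
    and \<kappa>d :: "real^'m \<Rightarrow> real" and V :: "nat \<Rightarrow> real" and k :: nat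
  assumes "closed K" and "convex K" and "cone K" and "K \<noteq> {}"
    and "convex X" and "compact X" and "convex \<Theta>" and "compact \<Theta>"
    and "\<theta>s \<in> \<Theta>"
    and f_proper: "\<And>y \<eta>. \<eta> \<in> \<Theta> \<Longrightarrow> f y \<eta> \<noteq> - \<infinity>"
    \<comment> \<open>standing assumption on the problem at \<open>\<theta>s\<close>\<close>
    and fs: "fs = opt_value K f h X \<theta>s"
    and fs_finite: "\<bar>fs\<bar> \<noteq> \<infinity>"
    and fs_attained: "\<exists>y\<in>feasible K h X \<theta>s. f y \<theta>s = fs"
    and dual_solvable: "dual_solutions K f h X \<theta>s \<noteq> {}"
    and no_gap: "(SUP \<mu>. dual_fun K f h X 0 \<mu> \<theta>s) = fs"
    \<comment> \<open>(i)\<close>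
    and h_affine: "\<And>y \<eta>. \<eta> \<in> \<Theta> \<Longrightarrow> h y \<eta> = A \<eta> *v y + b \<eta>"
    and A_lip: "\<And>\<eta>. \<eta> \<in> \<Theta> \<Longrightarrow> spectral_norm (A \<eta> - A \<theta>s) \<le> LA * norm (\<eta> - \<theta>s)"
    and b_lip: "\<And>\<eta>. \<eta> \<in> \<Theta> \<Longrightarrow> norm (b \<eta> - b \<theta>s) \<le> Lb * norm (\<eta> - \<theta>s)"
    and A_cont: "continuous_on \<Theta> (\<lambda>\<eta>. spectral_norm (A \<eta>))"
    \<comment> \<open>(ii); the two-sided form of the bound makes sense where \<open>f\<close> is infinite\<close>
    and f_convex: "\<And>\<eta>. \<eta> \<in> \<Theta> \<Longrightarrow> ereal_convex_on X (\<lambda>y. f y \<eta>)"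
    and f_lip: "\<And>\<eta> y. \<eta> \<in> \<Theta> \<Longrightarrow> y \<in> X \<Longrightarrow>
          f y \<eta> \<le> f y \<theta>s + ereal (Lf * norm (\<eta> - \<theta>s)) \<and>
          f y \<theta>s \<le> f y \<eta> + ereal (Lf * norm (\<eta> - \<theta>s))"
    \<comment> \<open>(iii); the minima defining the argmin sets are attained\<close>
    and argmin_nonempty: "\<And>\<mu> \<eta>. \<mu> \<in> dual_cone K \<Longrightarrow> \<eta> \<in> \<Theta> \<Longrightarrow> lagr_argmin K f h X \<mu> \<eta> \<noteq> {}"
    and \<kappa>_cont: "continuous_on (dual_cone K) \<kappa>"
    and \<kappa>_pos: "\<And>\<mu>. \<mu> \<in> dual_cone K \<Longrightarrow> 0 < \<kappa> \<mu>"
    and argmin_lip: "\<And>\<mu> \<eta>. \<mu> \<in> dual_cone K \<Longrightarrow> \<eta> \<in> \<Theta> \<Longrightarrow>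
          lagr_argmin K f h X \<mu> \<eta>
            \<subseteq> lagr_argmin K f h X \<mu> \<theta>s + (\<lambda>v. (\<kappa> \<mu> * norm (\<eta> - \<theta>s)) *\<^sub>R v) ` cball 0 1"
    \<comment> \<open>parameter sequence and algorithm\<close>
    and \<theta>_in: "\<And>i. \<theta> i \<in> \<Theta>"
    and \<tau>: "0 < \<tau>" "\<tau> < 1"
    and \<theta>_rate: "\<And>i. norm (\<theta> i - \<theta>s) \<le> \<tau> ^ i * norm (\<theta> 0 - \<theta>s)"
    and \<rho>: "0 < \<rho>"
    and \<alpha>_nonneg: "\<And>i. 0 \<le> \<alpha> i"
    and \<alpha>_summable: "summable (\<lambda>i. sqrt (\<alpha> i))"
    and ipalm: "ipalm K f h X (\<lambda>_. \<rho>) \<alpha> \<theta> x lam"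
    and xbar: "\<And>j. xbar j = (1 / real j) *\<^sub>R (\<Sum>i=1..j. x i)"
    and lams: "lams \<in> dual_solutions K f h X \<theta>s"
    \<comment> \<open>constants\<close>
    and Dx: "Dx = (SUP y\<in>X. norm y)"
    and Lh: "Lh = LA * Dx + Lb"
    and Lhx: "Lhx = (SUP \<eta>\<in>\<Theta>. spectral_norm (A \<eta>))"
    and \<kappa>d: "\<And>\<mu>. \<kappa>d \<mu> = Lh + \<kappa> \<mu> * Lhx"
    and \<kappa>bar: "\<kappa>bar = (SUP j\<in>{1..}. \<kappa>d (lam j))"
    and Clam: "Clam = sqrt (2 * \<rho>) * (\<Sum>i. sqrt (\<alpha> i))
                 + \<rho> * \<kappa>d lams * (norm (\<theta> 0 - \<theta>s) / (1 - \<tau>)) + norm (lam 0 - lams)"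
    and Bg: "Bg = 1 / (2 * \<rho>) * (norm (lam 0 - lams))\<^sup>2
                 + Clam * (sqrt (2 / \<rho>) * (\<Sum>i. sqrt (\<alpha> i))
                         + \<kappa>bar * norm (\<theta> 0 - \<theta>s) / (1 - \<tau>))"
    and C1: "C1 = sqrt (2 * Bg / \<rho> + (Clam / \<rho>)\<^sup>2)"
    and C2: "C2 = sqrt (2 / \<rho>) * (\<Sum>i. sqrt (\<alpha> i))
                 + (Lh + \<kappa>bar) * norm (\<theta> 0 - \<theta>s) / (1 - \<tau>)"
    and V: "\<And>j. V j = C1 / sqrt (real j) + C2 / real j"
    and Cbar: "Cbar = Clam + norm lams"
    and U: "U = (\<Sum>i. \<alpha> i) + 1 / (2 * \<rho>) * (norm (lam 0))\<^sup>2
                 + \<rho> / 2 * Lh\<^sup>2 * ((norm (\<theta> 0 - \<theta>s))\<^sup>2 / (1 - \<tau>\<^sup>2))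
                 + (Cbar * Lh + 2 * Lf) * (norm (\<theta> 0 - \<theta>s) / (1 - \<tau>))"
    and k: "1 \<le> k"
  shows "f (xbar k) \<theta>s - fs \<ge> ereal (- (\<rho> / 2) * (V k)\<^sup>2 - norm lams * V k)
       \<and> f (xbar k) \<theta>s - fs \<le> ereal (U / real k)"
proof -
  define D where "D = {y \<in> X. f y \<theta>s \<noteq> \<infinity>}"
  define F where "F = (\<lambda>\<eta> y. real_of_ereal (f y \<eta>))"
  define P where "P = (\<lambda>i. norm (\<theta> i - \<theta>s))"
  have \<theta>s: "\<theta>s \<in> \<Theta>" by fact
  interpret penalty_cone K \<rho> by unfold_locales (fact \<open>closed K\<close> \<open>convex K\<close> \<open>cone K\<close> \<open>K \<noteq> {}\<close> \<rho>)+

  have finite_iff: "y \<in> D \<longleftrightarrow> y \<in> X \<and> f y \<eta> \<noteq> \<infinity>" if "\<eta> \<in> \<Theta>" for y \<eta>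
    using f_lip[OF that, of y] by (cases "f y \<eta>"; cases "f y \<theta>s") (auto simp: D_def)
  have f_eq: "f y \<eta> = ereal (F \<eta> y)" if "\<eta> \<in> \<Theta>" "y \<in> D" for y \<eta>
    using finite_iff[OF that(1), of y] that f_proper[OF that(1), of y]
    by (cases "f y \<eta>") (auto simp: F_def)
  obtain xs where xs: "xs \<in> X" "- h xs \<theta>s \<in> K" "f xs \<theta>s = fs"
    using fs_attained by (auto simp: feasible_def)
  have xsD: "xs \<in> D" using xs fs_finite by (auto simp: D_def)
  have DX: "D \<subseteq> X" by (auto simp: D_def)

  have f_segment: "f ((1 - t) *\<^sub>R y + t *\<^sub>R z) \<eta> \<le> ereal (1 - t) * f y \<eta> + ereal t * f z \<eta>"
    if "\<eta> \<in> \<Theta>" "y \<in> D" "z \<in> D" "0 \<le> t" "t \<le> 1" for y z \<eta> t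
    using f_convex[OF that(1), unfolded ereal_convex_on_def, rule_format, of y z t] that DX by auto
  have convex_D: "convex D"
    unfolding convex_alt
  proof (intro ballI allI impI, elim conjE)
    fix y z and t :: real assume yz: "y \<in> D" "z \<in> D" and t: "0 \<le> t" "t \<le> 1"
    have "f ((1 - t) *\<^sub>R y + t *\<^sub>R z) \<theta>s \<le> ereal (1 - t) * f y \<theta>s + ereal t * f z \<theta>s"
      using f_segment[OF \<theta>s] yz t by blast
    also have "\<dots> < \<infinity>" by (simp add: f_eq[OF \<theta>s] yz)
    finally show "(1 - t) *\<^sub>R y + t *\<^sub>R z \<in> D"
      using \<open>convex X\<close> yz t DX by (auto simp: D_def convex_alt)
  qed
  have convex_F: "convex_on D (F \<eta>)" if \<eta>: "\<eta> \<in> \<Theta>" for \<eta>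
  proof (rule convex_onI[OF _ convex_D])
    fix t :: real and y z assume yz: "y \<in> D" "z \<in> D" and t: "0 < t" "t < 1"
    have "(1 - t) *\<^sub>R y + t *\<^sub>R z \<in> D" using convex_D yz t by (simp add: convex_alt)
    moreover have "f ((1 - t) *\<^sub>R y + t *\<^sub>R z) \<eta> \<le> ereal (1 - t) * f y \<eta> + ereal t * f z \<eta>"
      using f_segment[OF \<eta>] yz t by simp
    ultimately show "F \<eta> ((1 - t) *\<^sub>R y + t *\<^sub>R z) \<le> (1 - t) * F \<eta> y + t * F \<eta> z"
      by (simp add: f_eq[OF \<eta>] yz)
  qed

  have lagr0: "lagrangian K f h 0 y \<mu> \<eta> = ereal (F \<eta> y + \<mu> \<bullet> h y \<eta>)"
    if "\<mu> \<in> dual_cone K" "\<eta> \<in> \<Theta>" "y \<in> D" for y \<mu> \<eta>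
    using that by (simp add: lagrangian_def f_eq)
  \<comment> \<open>The feasible point \<open>xs\<close> has finite value, so points outside \<open>D\<close> never minimize a Lagrangian.\<close>
  have argmin_iff: "y \<in> lagr_argmin K f h X \<mu> \<eta> \<longleftrightarrow>
      y \<in> D \<and> (\<forall>z\<in>D. F \<eta> y + \<mu> \<bullet> h y \<eta> \<le> F \<eta> z + \<mu> \<bullet> h z \<eta>)"
    if \<mu>: "\<mu> \<in> dual_cone K" and \<eta>: "\<eta> \<in> \<Theta>" for y \<mu> \<eta>
  proof -
    let ?L = "\<lambda>y. lagrangian K f h 0 y \<mu> \<eta>"
    have top: "?L z = \<infinity>" if "z \<in> X" "z \<notin> D" for z
      using that finite_iff[OF \<eta>, of z] \<mu> by (simp add: lagrangian_def)
    have "y \<in> lagr_argmin K f h X \<mu> \<eta> \<longleftrightarrow> y \<in> X \<and> (\<forall>z\<in>X. ?L y \<le> ?L z)"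
      by (auto simp: lagr_argmin_def is_arg_min_def not_less)
    also have "\<dots> \<longleftrightarrow> y \<in> D \<and> (\<forall>z\<in>D. ?L y \<le> ?L z)"
    proof
      assume y: "y \<in> X \<and> (\<forall>z\<in>X. ?L y \<le> ?L z)"
      then have "?L y \<le> ?L xs" using xs by blast
      then have "?L y \<noteq> \<infinity>" by (auto simp: lagr0[OF \<mu> \<eta> xsD])
      then have "y \<in> D" using y top by blast
      then show "y \<in> D \<and> (\<forall>z\<in>D. ?L y \<le> ?L z)" using y DX by blast
    next
      assume y: "y \<in> D \<and> (\<forall>z\<in>D. ?L y \<le> ?L z)"
      have "?L y \<le> ?L z" if "z \<in> X" for z
        using y top[OF that] by (cases "z \<in> D") auto
      then show "y \<in> X \<and> (\<forall>z\<in>X. ?L y \<le> ?L z)" using y DX by blast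
    qed
    finally show ?thesis using lagr0[OF \<mu> \<eta>] by auto
  qed

  have program: "cone_program K \<rho> D (F \<eta>) (\<lambda>y. h y \<eta>)" if \<eta>: "\<eta> \<in> \<Theta>" for \<eta>
  proof unfold_locales
    show "D \<noteq> {}" using xsD by blast
    show "convex_on D (F \<eta>)" by (rule convex_F[OF \<eta>])
    show "h ((1 - t) *\<^sub>R y + t *\<^sub>R z) \<eta> = (1 - t) *\<^sub>R h y \<eta> + t *\<^sub>R h z \<eta>" for y z t
      by (simp add: h_affine[OF \<eta>] matrix_vector_right_distrib matrix_vector_mult_scaleR algebra_simps)
    show "\<exists>y\<in>D. \<forall>z\<in>D. F \<eta> y + \<mu> \<bullet> h y \<eta> \<le> F \<eta> z + \<mu> \<bullet> h z \<eta>" if \<mu>: "\<mu> \<in> dual_cone K" for \<mu>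
      using argmin_nonempty[OF \<mu> \<eta>] argmin_iff[OF \<mu> \<eta>] by blast
  qed
  interpret ref: cone_program K \<rho> D "F \<theta>s" "\<lambda>y. h y \<theta>s" by (rule program[OF \<theta>s])

  have dual_eq: "dual_fun K f h X 0 \<mu> \<theta>s = ereal (ref.dual_value \<mu>)" if \<mu>: "\<mu> \<in> dual_cone K" for \<mu>
  proof -
    obtain y where y: "y \<in> D" "ref.dual_value \<mu> = F \<theta>s y + \<mu> \<bullet> h y \<theta>s"
      and "\<And>z. z \<in> D \<Longrightarrow> F \<theta>s y + \<mu> \<bullet> h y \<theta>s \<le> F \<theta>s z + \<mu> \<bullet> h z \<theta>s"
      using ref.dual_value_attained[OF \<mu>] by metis
    then have "y \<in> lagr_argmin K f h X \<mu> \<theta>s" by (simp add: argmin_iff[OF \<mu> \<theta>s])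
    then have "dual_fun K f h X 0 \<mu> \<theta>s = lagrangian K f h 0 y \<mu> \<theta>s"
      unfolding dual_fun_def
      by (intro INF_eqI) (auto simp: lagr_argmin_def is_arg_min_def not_less)
    then show ?thesis using y by (simp add: lagr0[OF \<mu> \<theta>s])
  qed
  have lams_max: "dual_fun K f h X 0 \<mu> \<theta>s \<le> dual_fun K f h X 0 lams \<theta>s" for \<mu>
    using lams by (auto simp: dual_solutions_def is_arg_max_def not_less)
  have lams_value: "dual_fun K f h X 0 lams \<theta>s = fs"
    unfolding no_gap[symmetric] using lams_max by (intro antisym SUP_upper SUP_least) auto
  have lams_in: "lams \<in> dual_cone K"
  proof (rule ccontr)
    assume "lams \<notin> dual_cone K"
    moreover have "X \<noteq> {}" using xs(1) by blast
    ultimately have "dual_fun K f h X 0 lams \<theta>s = - \<infinity>"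
      unfolding dual_fun_def by (simp add: lagrangian_def cINF_const)
    then show False using lams_value fs_finite by simp
  qed
  have fs_eq: "fs = ereal (ref.dual_value lams)" using lams_value dual_eq[OF lams_in] by simp
  have lams_opt: "ref.dual_value \<mu> \<le> ref.dual_value lams" if "\<mu> \<in> dual_cone K" for \<mu>
    using lams_max[of \<mu>] dual_eq[OF that] dual_eq[OF lams_in] by simp

  have norm_X: "norm y \<le> Dx" if "y \<in> X" for y
    unfolding Dx using that compact_continuous_image[OF continuous_on_norm_id \<open>compact X\<close>]
    by (intro cSUP_upper bounded_imp_bdd_above compact_imp_bounded)
  have A_bound: "spectral_norm (A \<eta>) \<le> Lhx" if "\<eta> \<in> \<Theta>" for \<eta>
    unfolding Lhx using that compact_continuous_image[OF A_cont \<open>compact \<Theta>\<close>]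
    by (intro cSUP_upper bounded_imp_bdd_above compact_imp_bounded)
  have Lhx0: "0 \<le> Lhx" using A_bound[OF \<theta>s] spectral_norm_nonneg order_trans by blast
  have h_close: "norm (h y \<eta> - h z \<theta>s) \<le> Lhx * norm (y - z) + Lh * norm (\<eta> - \<theta>s)"
    if \<eta>: "\<eta> \<in> \<Theta>" and z: "z \<in> X" for y z \<eta>
  proof -
    have eq: "h y \<eta> - h z \<theta>s = A \<eta> *v (y - z) + ((A \<eta> - A \<theta>s) *v z + (b \<eta> - b \<theta>s))"
      by (simp add: h_affine[OF \<eta>] h_affine[OF \<theta>s] matrix_vector_mult_diff_distrib
          matrix_vector_mult_diff_rdistrib)
    have "norm (A \<eta> *v (y - z)) \<le> Lhx * norm (y - z)"
      using norm_le_spectral_norm A_bound[OF \<eta>] by (meson mult_right_mono norm_ge_zero order_trans)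
    moreover have "norm ((A \<eta> - A \<theta>s) *v z) \<le> LA * norm (\<eta> - \<theta>s) * Dx"
      using norm_le_spectral_norm[of "A \<eta> - A \<theta>s" z] A_lip[OF \<eta>] norm_X[OF z]
        spectral_norm_nonneg[of "A \<eta> - A \<theta>s"]
      by (meson mult_mono norm_ge_zero order_trans)
    ultimately have "norm (h y \<eta> - h z \<theta>s)
        \<le> Lhx * norm (y - z) + (LA * norm (\<eta> - \<theta>s) * Dx + Lb * norm (\<eta> - \<theta>s))"
      unfolding eq using b_lip[OF \<eta>] by (intro norm_triangle_le add_mono norm_triangle_mono)
    then show ?thesis by (simp add: Lh algebra_simps)
  qed

  have \<kappa>d_cont: "continuous_on (dual_cone K) \<kappa>d"
    unfolding \<kappa>d[abs_def] by (intro continuous_intros \<kappa>_cont)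
  have perturbed: "perturbed_program K \<rho> D (F \<theta>s) (F (\<theta> i)) (\<lambda>y. h y \<theta>s) (\<lambda>y. h y (\<theta> i)) lams \<kappa>d (P i)
      (Lf * P i) (Lh * P i)" for i
  proof -
    interpret pert: cone_program K \<rho> D "F (\<theta> i)" "\<lambda>y. h y (\<theta> i)" by (rule program[OF \<theta>_in])
    show ?thesis
    proof unfold_locales
      show "lams \<in> dual_cone K" "continuous_on (dual_cone K) \<kappa>d" by fact+
      show "ref.dual_value \<mu> \<le> ref.dual_value lams" if "\<mu> \<in> dual_cone K" for \<mu>
        using that by (rule lams_opt)
      show "\<bar>F (\<theta> i) y - F \<theta>s y\<bar> \<le> Lf * P i" if "y \<in> D" for y
        using f_lip[OF \<theta>_in[of i], of y] that DX
        by (auto simp: f_eq[OF \<theta>_in] f_eq[OF \<theta>s] P_def abs_le_iff)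
      show "norm (h y (\<theta> i) - h y \<theta>s) \<le> Lh * P i" if "y \<in> D" for y
        using h_close[OF \<theta>_in, of y y i] that DX by (auto simp: P_def)
    next
      fix \<mu> y assume \<mu>: "\<mu> \<in> dual_cone K" and "y \<in> D"
        and "\<And>z. z \<in> D \<Longrightarrow> F (\<theta> i) y + \<mu> \<bullet> h y (\<theta> i) \<le> F (\<theta> i) z + \<mu> \<bullet> h z (\<theta> i)"
      then have "y \<in> lagr_argmin K f h X \<mu> (\<theta> i)" by (simp add: argmin_iff[OF \<mu> \<theta>_in])
      with argmin_lip[OF \<mu> \<theta>_in] obtain y' w where y': "y' \<in> lagr_argmin K f h X \<mu> \<theta>s"
        and w: "norm w \<le> 1" "y = y' + (\<kappa> \<mu> * P i) *\<^sub>R w"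
        by (fastforce simp: set_plus_def P_def)
      have "norm (y - y') \<le> \<kappa> \<mu> * P i"
        using w \<kappa>_pos[OF \<mu>] by (simp add: P_def abs_mult mult_left_le)
      then have "Lhx * norm (y - y') \<le> Lhx * (\<kappa> \<mu> * P i)" using Lhx0 by (rule mult_left_mono)
      moreover have "y' \<in> X" using y' DX by (auto simp: argmin_iff[OF \<mu> \<theta>s])
      ultimately have "norm (h y (\<theta> i) - h y' \<theta>s) \<le> \<kappa>d \<mu> * P i"
        using h_close[OF \<theta>_in[of i], of y' y] by (simp add: P_def \<kappa>d algebra_simps)
      then show "\<exists>y'\<in>D. (\<forall>z\<in>D. F \<theta>s y' + \<mu> \<bullet> h y' \<theta>s \<le> F \<theta>s z + \<mu> \<bullet> h z \<theta>s)
          \<and> norm (h y (\<theta> i) - h y' \<theta>s) \<le> \<kappa>d \<mu> * P i"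
        using y' by (auto simp: argmin_iff[OF \<mu> \<theta>s])
    qed
  qed

  have lagr: "lagrangian K f h \<rho> y v \<eta> = ereal (F \<eta> y + penalty K \<rho> v (h y \<eta>))"
    if "\<eta> \<in> \<Theta>" "y \<in> D" for y v \<eta>
    using that \<rho> by (simp add: lagrangian_def penalty_def f_eq)
  have step: "x (Suc i) \<in> X"
    "lagrangian K f h \<rho> (x (Suc i)) (lam i) (\<theta> i) \<le> dual_fun K f h X \<rho> (lam i) (\<theta> i) + ereal (\<alpha> i)"
    "lam (Suc i) = multiplier_step K \<rho> (lam i) (h (x (Suc i)) (\<theta> i))" for i
    using ipalm by (auto simp: ipalm_def multiplier_step_def grad_lagrangian_def)
  have le_all: "lagrangian K f h \<rho> (x (Suc i)) (lam i) (\<theta> i)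
      \<le> ereal (F (\<theta> i) z + penalty K \<rho> (lam i) (h z (\<theta> i)) + \<alpha> i)" if "z \<in> D" for i z
  proof -
    have "dual_fun K f h X \<rho> (lam i) (\<theta> i) \<le> lagrangian K f h \<rho> z (lam i) (\<theta> i)"
      unfolding dual_fun_def using that DX by (intro INF_lower) auto
    then have "dual_fun K f h X \<rho> (lam i) (\<theta> i) + ereal (\<alpha> i)
        \<le> lagrangian K f h \<rho> z (lam i) (\<theta> i) + ereal (\<alpha> i)"
      by (rule add_right_mono)
    with step(2)[of i] show ?thesis using that by (simp add: lagr[OF \<theta>_in])
  qed
  \<comment> \<open>Likewise an approximate minimizer of the augmented Lagrangian has finite objective.\<close>
  have x_D: "x (Suc i) \<in> D" for i
  proof -
    have "f (x (Suc i)) (\<theta> i) \<noteq> \<infinity>"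
      using le_all[OF xsD, of i] \<rho> by (auto simp: lagrangian_def)
    then show ?thesis using step(1) finite_iff[OF \<theta>_in] by blast
  qed

  interpret M: perturbed_multiplier_method K \<rho> D "F \<theta>s" "\<lambda>i. F (\<theta> i)" "\<lambda>y. h y \<theta>s" "\<lambda>i y. h y (\<theta> i)"
    lams \<kappa>d P Lf Lh \<tau> \<alpha> x lam
  proof (rule perturbed_multiplier_method.intro)
    show "F (\<theta> i) (x (Suc i)) + penalty K \<rho> (lam i) (h (x (Suc i)) (\<theta> i))
        \<le> F (\<theta> i) z + penalty K \<rho> (lam i) (h z (\<theta> i)) + \<alpha> i" if "z \<in> D" for i z
      using le_all[OF that, of i] by (simp add: lagr[OF \<theta>_in x_D])
  qed (use perturbed \<theta>_rate \<tau> \<alpha>_nonneg \<alpha>_summable x_D step(3) in \<open>auto simp: P_def\<close>)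

  have radius: "M.radius = Clam" unfolding M.radius_def Clam by (simp add: P_def)
  have xbar_eq: "xbar k = (\<Sum>i<k. (1 / real k) *\<^sub>R x (Suc i))"
    by (simp add: xbar scaleR_sum_right sum.atLeast1_atMost_eq)
  have weights: "(\<Sum>i<k. 1 / real k) = 1" using k by simp
  have xbar_D: "xbar k \<in> D"
    unfolding xbar_eq using weights x_D by (intro convex_sum convex_D) auto
  then have f_xbar: "f (xbar k) \<theta>s - fs = ereal (F \<theta>s (xbar k) - ref.dual_value lams)"
    by (simp add: f_eq[OF \<theta>s] fs_eq)

  have "F \<theta>s (xbar k) \<le> (\<Sum>i<k. 1 / real k * F \<theta>s (x (Suc i)))"
    unfolding xbar_eq using weights x_D k
    by (intro convex_on_sum[OF _ _ convex_F[OF \<theta>s]]) (auto simp: lessThan_empty_iff)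
  also have "\<dots> = (\<Sum>i<k. F \<theta>s (x (Suc i)) - F \<theta>s xs) / real k + F \<theta>s xs"
    using k by (simp add: sum_subtractf diff_divide_distrib flip: sum_divide_distrib)
  also have "\<dots> \<le> U / real k + F \<theta>s xs"
    using M.objective_sum_le[OF xsD xs(2), of k] unfolding radius
    by (intro add_right_mono divide_right_mono) (simp_all add: U Cbar P_def)
  also have "F \<theta>s xs = ref.dual_value lams"
    using f_eq[OF \<theta>s xsD] xs(3) fs_eq by simp
  finally have upper: "F \<theta>s (xbar k) - ref.dual_value lams \<le> U / real k" by simp

  have lam_in: "lam (Suc i) \<in> dual_cone K" for i
    unfolding step(3) by (rule multiplier_step_in)
  \<comment> \<open>The multipliers stay in a compact part of the dual cone, so \<open>\<kappa>bar\<close> is a supremum of a bounded set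
    and at least its first term, which is nonnegative unless all perturbations vanish.\<close>
  have "bdd_above (\<kappa>d ` (dual_cone K \<inter> cball lams Clam))"
    using \<kappa>d_cont closed_dual_cone[of K]
    by (intro bounded_imp_bdd_above compact_imp_bounded compact_continuous_image closed_Int_compact)
      (auto elim: continuous_on_subset)
  moreover have "(\<lambda>j. \<kappa>d (lam j)) ` {1..} \<subseteq> \<kappa>d ` (dual_cone K \<inter> cball lams Clam)"
  proof (intro image_subsetI)
    fix j :: nat assume "j \<in> {1..}"
    then obtain i where "j = Suc i" by (cases j) auto
    then have "lam j \<in> dual_cone K \<inter> cball lams Clam"
      using lam_in M.multiplier_distance[of j] by (simp add: radius dist_norm norm_minus_commute)
    then show "\<kappa>d (lam j) \<in> \<kappa>d ` (dual_cone K \<inter> cball lams Clam)" by (rule imageI)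
  qed
  ultimately have "bdd_above ((\<lambda>j. \<kappa>d (lam j)) ` {1..})" by (rule bdd_above_mono)
  then have "\<kappa>d (lam 1) \<le> \<kappa>bar"
    unfolding \<kappa>bar by (intro cSUP_upper) auto
  then have "\<kappa>d (lam 1) * P 0 \<le> \<kappa>bar * P 0" by (intro mult_right_mono) (auto simp: P_def)
  then have \<kappa>bar0: "0 \<le> \<kappa>bar * norm (\<theta> 0 - \<theta>s)"
    using M.nonneg_moduli(3)[OF lam_in[of 0], of 0] by (simp add: P_def)
  define S where "S = (\<Sum>i. sqrt (\<alpha> i))"
  have S0: "0 \<le> S" unfolding S_def using \<alpha>_summable \<alpha>_nonneg by (intro suminf_nonneg) auto
  have Clam0: "0 \<le> Clam"
    using M.multiplier_distance[of 0] norm_ge_zero order_trans unfolding radius by blast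
  define a where "a = norm (lam 0 - lams)"
  define tail where "tail = \<kappa>bar * norm (\<theta> 0 - \<theta>s) / (1 - \<tau>)"
  have tail0: "0 \<le> tail" unfolding tail_def using \<kappa>bar0 \<tau> by (intro divide_nonneg_nonneg) auto
  have "0 \<le> Clam * (sqrt (2 / \<rho>) * S + tail)"
    using Clam0 S0 tail0 \<rho> by (intro mult_nonneg_nonneg add_nonneg_nonneg) auto
  then have "a\<^sup>2 / (2 * \<rho>) \<le> Bg" by (simp add: Bg S_def a_def tail_def)
  then have "a\<^sup>2 / \<rho>\<^sup>2 \<le> 2 * Bg / \<rho>" using \<rho> by (simp add: field_simps power2_eq_square)
  then have "sqrt ((a\<^sup>2 + Clam\<^sup>2) / \<rho>\<^sup>2) \<le> C1"
    unfolding C1 by (intro real_sqrt_le_mono) (simp add: add_divide_distrib power_divide)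
  then have C1_ge: "sqrt (a\<^sup>2 + Clam\<^sup>2) / \<rho> \<le> C1" using \<rho> by (simp add: real_sqrt_divide)
  have C2_ge: "Lh * (P 0 / (1 - \<tau>)) \<le> C2"
  proof -
    have "C2 = sqrt (2 / \<rho>) * S + Lh * (P 0 / (1 - \<tau>)) + tail"
      by (simp add: C2 S_def tail_def P_def distrib_right add_divide_distrib)
    moreover have "0 \<le> sqrt (2 / \<rho>) * S" using S0 \<rho> by simp
    ultimately show ?thesis using tail0 by linarith
  qed
  \<comment> \<open>Infeasibility of the average, multiplied by \<open>k\<close>:
    total multiplier displacement plus accumulated drift of the constraint.\<close>
  have V_ge: "norm (lam k - lam 0) / \<rho> + Lh * (P 0 / (1 - \<tau>)) \<le> V k * real k"
  proof -
    have "norm (lam k - lam 0) / \<rho> \<le> sqrt (real k) * sqrt (a\<^sup>2 + Clam\<^sup>2) / \<rho>"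
      using M.multiplier_displacement[OF k] \<rho> by (intro divide_right_mono) (auto simp: radius a_def)
    also have "\<dots> = sqrt (real k) * (sqrt (a\<^sup>2 + Clam\<^sup>2) / \<rho>)" by simp
    also have "\<dots> \<le> sqrt (real k) * C1" using C1_ge by (intro mult_left_mono) auto
    also have "\<dots> = C1 / sqrt (real k) * real k" using k by (simp add: field_simps)
    finally have "norm (lam k - lam 0) / \<rho> \<le> C1 / sqrt (real k) * real k" .
    moreover have "V k * real k = C1 / sqrt (real k) * real k + C2"
      unfolding V using k by (simp add: distrib_right)
    ultimately show ?thesis using C2_ge by linarith
  qed
  have h_xbar: "lams \<bullet> h (xbar k) \<theta>s = (\<Sum>i<k. lams \<bullet> h (x (Suc i)) \<theta>s) / real k"
  proof -
    have "A \<theta>s *v xbar k = (\<Sum>i<k. (1 / real k) *\<^sub>R (A \<theta>s *v x (Suc i)))"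
      unfolding xbar_eq by (simp add: linear_sum[OF matrix_vector_mul_linear] matrix_vector_mult_scaleR)
    then show ?thesis
      using k by (simp add: h_affine[OF \<theta>s] inner_add_right inner_sum_right sum.distrib add_divide_distrib
          sum_divide_distrib)
  qed
  \<comment> \<open>Since \<open>lams\<close> closes the duality gap,
    an average with small infeasibility cannot have value far below \<open>fs\<close>.\<close>
  have "lams \<bullet> h (xbar k) \<theta>s \<le> norm lams * (norm (lam k - lam 0) / \<rho> + Lh * (P 0 / (1 - \<tau>))) / real k"
    unfolding h_xbar by (intro divide_right_mono M.constraint_sum_le) simp
  also have "\<dots> \<le> norm lams * (V k * real k) / real k"
    using V_ge by (intro divide_right_mono mult_left_mono) auto
  also have "\<dots> = norm lams * V k" using k by simp
  finally have "F \<theta>s (xbar k) \<ge> ref.dual_value lams - norm lams * V k"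
    using ref.dual_value_le[OF lams_in xbar_D] by simp
  moreover have "0 \<le> \<rho> / 2 * (V k)\<^sup>2" using \<rho> by simp
  ultimately have lower: "F \<theta>s (xbar k) - ref.dual_value lams \<ge> - (\<rho> / 2) * (V k)\<^sup>2 - norm lams * V k"
    by simp
  show ?thesis using lower upper by (simp add: f_xbar)
qed

end
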